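(* Let $\mathcal H\subset\mathbb R^2$ be a nonempty bounded open set with $B_2(0)\subset\mathcal H\subset B_{\mathcal R}(0)$ for some $\mathcal R\in(2,\infty)$. Let $J\in C^2_c(\mathbb R^2)$ be radially symmetric with $J(x)>0$ if $|x|<d$, $J(x)=0$ if $|x|\ge d$ (for some $d>0$), and $\int_{\mathbb R^2}J=1$. Let $u_0\ge0$ with $u_0=0$ in $\mathcal H$ and $u_0\in L^\infty(\mathbb R^2)\cap L^1(\mathbb R^2,\log|x|\,dx)$. Let $u$ be the solution of the nonlocal exterior problem with hole $\mathcal H$ and initial datum $u_0$. Then there exist $t_0>1$ and $C_0>0$ such that $$M(t):=\int_{\mathbb R^2}u(x,t)\,dx\le\frac{C_0}{\log t}\quad\text{if }t\ge t_0.$$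
   Context: $L$ is the operator $Lg:=J*g-g$. The solution $u\in C([0,\infty);L^1(\mathbb R^2))$ is the unique solution of: $\partial_tu=Lu$ in $(\mathbb R^2\setminus\mathcal H)\times(0,\infty)$, $u=0$ in $\mathcal H\times(0,\infty)$, $u(\cdot,0)=u_0$ in $\mathbb R^2$. *)

theory Defs
  imports "HOL-Analysis.Analysis"
begin

(* C^2 in the Frechet sense: the derivative D1 is itself differentiable,
   with a continuous derivative D2 (continuity of f and D1 is then automatic). *)
definition C2 :: "(real^2 \<Rightarrow> real) \<Rightarrow> bool" where
  "C2 f \<longleftrightarrow> (\<exists>(D1 :: real^2 \<Rightarrow> ((real^2) \<Rightarrow>\<^sub>L real)) (D2 :: real^2 \<Rightarrow> ((real^2) \<Rightarrow>\<^sub>L ((real^2) \<Rightarrow>\<^sub>L real))).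
     (\<forall>x. (f has_derivative blinfun_apply (D1 x)) (at x)) \<and>
     (\<forall>x. (D1 has_derivative blinfun_apply (D2 x)) (at x)) \<and>
     continuous_on UNIV D2)"

definition compactly_supported :: "(real^2 \<Rightarrow> real) \<Rightarrow> bool" where
  "compactly_supported f \<longleftrightarrow> compact (closure {x. f x \<noteq> 0})"

definition radially_symmetric :: "(real^2 \<Rightarrow> real) \<Rightarrow> bool" where
  "radially_symmetric f \<longleftrightarrow> (\<forall>x y. norm x = norm y \<longrightarrow> f x = f y)"

definition convolution :: "(real^2 \<Rightarrow> real) \<Rightarrow> (real^2 \<Rightarrow> real) \<Rightarrow> real^2 \<Rightarrow> real" where
  "convolution f g x = (LINT y|lebesgue. f (x - y) * g y)"

definition nonlocal_op :: "(real^2 \<Rightarrow> real) \<Rightarrow> (real^2 \<Rightarrow> real) \<Rightarrow> real^2 \<Rightarrow> real" where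
  "nonlocal_op J g x = convolution J g x - g x"

definition in_L_infinity :: "(real^2 \<Rightarrow> real) \<Rightarrow> bool" where
  "in_L_infinity g \<longleftrightarrow> g \<in> borel_measurable lebesgue \<and> (\<exists>B. AE x in lebesgue. \<bar>g x\<bar> \<le> B)"

(* The weight log |x| is negative in the unit disc; the space is only used for functions
   vanishing almost everywhere in the disc of radius 2, where its sign is immaterial. *)
definition in_L1_log :: "(real^2 \<Rightarrow> real) \<Rightarrow> bool" where
  "in_L1_log g \<longleftrightarrow> g \<in> borel_measurable lebesgue \<and> integrable lebesgue (\<lambda>x. g x * ln (norm x))"

(* u t is a representative of the class u(.,t) in L^1. Only times t >= 0 matter. *)
definition continuous_into_L1 :: "(real \<Rightarrow> real^2 \<Rightarrow> real) \<Rightarrow> bool" where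
  "continuous_into_L1 u \<longleftrightarrow>
     (\<forall>t\<ge>0. integrable lebesgue (u t)) \<and>
     (\<forall>t\<ge>0. ((\<lambda>s. LINT x|lebesgue. \<bar>u s x - u t x\<bar>) \<longlongrightarrow> 0) (at t within {0..}))"

(* The time derivative is that of an L^1-valued function: the difference quotients converge
   to L u(.,t) in the norm of L^1 of the complement of the hole. This does not depend on the
   choice of representatives; accordingly, the other conditions hold almost everywhere in x. *)
definition exterior_solution ::
  "(real^2 \<Rightarrow> real) \<Rightarrow> (real^2) set \<Rightarrow> (real^2 \<Rightarrow> real) \<Rightarrow> (real \<Rightarrow> real^2 \<Rightarrow> real) \<Rightarrow> bool" where
  "exterior_solution J H u0 u \<longleftrightarrow>
     continuous_into_L1 u \<and>
     (\<forall>t>0. ((\<lambda>h. LINT x:(- H)|lebesgue. \<bar>(u (t + h) x - u t x) / h - nonlocal_op J (u t) x\<bar>)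
               \<longlongrightarrow> 0) (at 0)) \<and>
     (\<forall>t>0. AE x in lebesgue. x \<in> H \<longrightarrow> u t x = 0) \<and>
     (AE x in lebesgue. u 0 x = u0 x)"

definition mass :: "(real \<Rightarrow> real^2 \<Rightarrow> real) \<Rightarrow> real \<Rightarrow> real" where
  "mass u t = (LINT x|lebesgue. u t x)"

end

theory Submission
  imports Defs
begin

text \<open>
  Testing the equation against bounded functions and iterating (Duhamel) gives
  \<open>M(t) = e\<^sup>-\<^sup>t \<Sum>k. t\<^sup>k/k! \<integral> u\<^sub>0 q\<^sub>k\<close>, where \<open>q\<^sub>0\<close> is the indicator of the complement of \<open>H\<close> and
  \<open>q\<^sub>k\<^sub>+\<^sub>1\<close> is \<open>J * q\<^sub>k\<close> restricted to that complement. By comparison,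
  \<open>q\<^sub>k \<le> 4 G\<^sub>k + \<psi> / ln n\<close> for two functions with \<open>1 \<le> 4 G\<^sub>0 + \<psi> / ln n\<close> off \<open>H\<close>:
  a supersolution \<open>\<psi> = K + ln \<bar>x\<bar>\<close>, which controls the part of the plane with \<open>\<bar>x\<bar> \<ge> n\<close>, and
  \<open>G\<^sub>k = J * \<dots> * J * G\<^sub>0\<close> for a nonnegative trigonometric polynomial \<open>G\<^sub>0\<close> bounded below
  for \<open>\<bar>x\<bar> \<le> n\<close>, for which \<open>G\<^sub>k \<le> 2 / n\<close> once \<open>k \<ge> n\<^sup>6\<close>. Hence \<open>\<integral> u\<^sub>0 q\<^sub>k\<close> is of order \<open>1 / ln n\<close> for
  \<open>k \<ge> n\<^sup>6\<close>, and for \<open>n\<close> of order \<open>t\<^sup>1\<^sup>/\<^sup>1\<^sup>2\<close> the Poisson weights of the other \<open>k\<close> are negligible.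
\<close>

section \<open>Averages against a radial kernel\<close>

lemma lborel_reflect: "distr lborel borel (\<lambda>y::real^2. x - y) = lborel"
  using lborel_affine[of "-1" x] by (simp add: density_1)

lemma integral_reflect:
  fixes f :: "real^2 \<Rightarrow> real"
  assumes [measurable]: "f \<in> borel_measurable borel"
  shows "(LINT y|lborel. f (x - y)) = (LINT y|lborel. f y)"
proof -
  have "(LINT y|lborel. f y) = (LINT y|distr lborel borel (\<lambda>y. x - y). f y)"
    by (simp add: lborel_reflect)
  also have "\<dots> = (LINT y|lborel. f (x - y))"
    by (rule integral_distr) auto
  finally show ?thesis by simp
qed

lemma integrable_reflect:
  fixes f :: "real^2 \<Rightarrow> real"
  assumes "integrable lborel f"
  shows "integrable lborel (\<lambda>y. f (x - y))"
proof -
  have "integrable (distr lborel borel (\<lambda>y. x - y)) f"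
    using assms by (simp add: lborel_reflect)
  then show ?thesis
    using assms by (subst (asm) integrable_distr_eq) auto
qed

text \<open>Change of variables with |det T| = 1. Applied to rotations, under which \<open>J\<close>
  is invariant, it drives the doubling argument for the logarithm.\<close>

lemma integral_orthogonal:
  fixes f :: "real^2 \<Rightarrow> real" and T :: "real^2 \<Rightarrow> real^2"
  assumes "orthogonal_transformation T" and f: "integrable lborel f"
  shows "(LINT y|lborel. f (T y)) = (LINT y|lborel. f y)" "integrable lborel (\<lambda>y. f (T y))"
proof -
  have lin: "linear T" and det: "\<bar>det (matrix T)\<bar> = 1" and sur: "range T = UNIV"
    using assms(1) orthogonal_transformation_linear orthogonal_transformation_surj by auto
  have [measurable]: "T \<in> borel_measurable borel" "f \<in> borel_measurable borel"
    using lin f by (auto intro!: borel_measurable_continuous_onI linear_continuous_on simp: linear_conv_bounded_linear)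
  have fl: "integrable lebesgue f"
    using f by (simp add: integrable_completion)
  \<comment> \<open>The linear change of variables concerns vector-valued maps, so \<open>f\<close>
    is viewed as a map into \<open>real^1\<close>.\<close>
  define g where "g = (\<lambda>x. vec (f x) :: real^1)"
  have "f absolutely_integrable_on UNIV"
    using fl by (simp add: set_integrable_def)
  then have *: "(\<lambda>y. f (T y)) absolutely_integrable_on UNIV"
     "integral UNIV (\<lambda>y. f (T y)) = integral UNIV f"
    using has_absolute_integral_change_of_variables_linear[OF lin, where f=g and S=UNIV and b="integral UNIV g"]
      absolutely_integrable_on_1_iff[where f=g and S=UNIV] absolutely_integrable_on_1_iff[where f="\<lambda>y. g (T y)" and S=UNIV]
      integral_on_1_eq[where f=g and S=UNIV] integral_on_1_eq[where f="\<lambda>y. g (T y)" and S=UNIV] det sur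
    by (auto simp: g_def)
  have l: "integrable lebesgue (\<lambda>y. f (T y))"
    using *(1) by (simp add: set_integrable_def)
  then show "integrable lborel (\<lambda>y. f (T y))"
    by (simp add: integrable_completion)
  have "(LINT y|lebesgue. f (T y)) = (LINT y|lebesgue. f y)"
    using *(2) integral_lebesgue[OF l] integral_lebesgue[OF fl] by simp
  then show "(LINT y|lborel. f (T y)) = (LINT y|lborel. f y)"
    by (simp add: integral_completion)
qed

locale radial_kernel =
  fixes J :: "real^2 \<Rightarrow> real" and d :: real
  assumes J_cont: "continuous_on UNIV J"
    and J_radial: "\<And>x y. norm x = norm y \<Longrightarrow> J x = J y"
    and d_pos: "0 < d"
    and J_pos: "\<And>x. norm x < d \<Longrightarrow> J x > 0"
    and J_zero: "\<And>x. norm x \<ge> d \<Longrightarrow> J x = 0"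
    and J_mass: "(LINT x|lborel. J x) = 1"
begin

lemma J_measurable [measurable]: "J \<in> borel_measurable borel"
  using J_cont by (rule borel_measurable_continuous_onI)

lemma J_nonneg: "0 \<le> J x"
  using J_pos[of x] J_zero[of x] by (cases "norm x < d") auto

text \<open>A non-integrable function has integral 0 by convention, so total mass 1 forces
  integrability.\<close>

lemma J_integrable: "integrable lborel J"
  using J_mass not_integrable_integral_eq by fastforce

lemma J_minus: "J (- x) = J x"
  by (rule J_radial) simp

lemma J_commute: "J (x - y) = J (y - x)"
  by (rule J_radial) (simp add: norm_minus_commute)

end

section \<open>The logarithm is harmonic for radial averages\<close>

text \<open>Complex coordinates give access to powers, roots of unity and the factorisation of
  differences of powers.\<close>

definition cplx :: "real^2 \<Rightarrow> complex" where
  "cplx x = Complex (x $ 1) (x $ 2)"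

definition rot :: "real \<Rightarrow> real^2 \<Rightarrow> real^2" where
  "rot a x = vector [cos a * x $ 1 - sin a * x $ 2, sin a * x $ 1 + cos a * x $ 2]"

lemma norm_cplx [simp]: "norm (cplx x) = norm x"
  by (simp add: cplx_def cmod_def norm_vec_def L2_set_def sum_2)

lemma cplx_rot: "cplx (rot a x) = cis a * cplx x"
  by (simp add: cplx_def rot_def complex_eq_iff)

lemma cplx_diff: "cplx (x - y) = cplx x - cplx y"
  by (simp add: cplx_def complex_eq_iff)

lemma continuous_on_cplx [continuous_intros]: "continuous_on S cplx"
  unfolding cplx_def by (intro continuous_intros)

lemma borel_measurable_cplx [measurable]: "cplx \<in> borel_measurable borel"
  by (intro borel_measurable_continuous_onI continuous_intros)

lemma orthogonal_transformation_rot: "orthogonal_transformation (rot a)"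
proof -
  have "linear (rot a)"
    by (rule linearI) (simp_all add: rot_def vec_eq_iff forall_2 algebra_simps)
  moreover have "norm (rot a x) = norm x" for x
    by (metis cplx_rot norm_cplx norm_cis norm_mult mult_1)
  ultimately show ?thesis
    by (simp add: orthogonal_transformation)
qed

text \<open>Here |w|^n <= d^n < |z|^n. The upper bound exceeds n ln |z| by ln 2 whatever n is, an
  error that disappears after division by n; the lower bound keeps the logarithm integrable against
  \<open>J\<close>.\<close>

lemma ln_norm_power_diff_bounds:
  fixes z w :: complex
  assumes "norm w < d" "d < norm z" "0 < n"
  shows "ln (norm z ^ n - d ^ n) \<le> ln (norm (z ^ n - w ^ n))"
    and "ln (norm (z ^ n - w ^ n)) \<le> n * ln (norm z) + ln 2"
    and "0 < norm (z ^ n - w ^ n)"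
proof -
  have d: "0 < d" using assms(1) norm_ge_zero[of w] by linarith
  have w: "norm w ^ n \<le> d ^ n" and z: "d ^ n < norm z ^ n"
    using assms d by (auto intro!: power_mono power_strict_mono)
  have low: "norm z ^ n - d ^ n \<le> norm (z ^ n - w ^ n)"
    using norm_triangle_ineq2[of "z^n" "w^n"] w by (simp add: norm_power)
  show pos: "0 < norm (z ^ n - w ^ n)" using low z by linarith
  show "ln (norm z ^ n - d ^ n) \<le> ln (norm (z ^ n - w ^ n))"
    using low z by (intro ln_mono) auto
  have "norm (z ^ n - w ^ n) \<le> norm z ^ n * 2"
    using norm_triangle_ineq4[of "z^n" "w^n"] w z by (simp add: norm_power)
  then have "ln (norm (z ^ n - w ^ n)) \<le> ln (norm z ^ n * 2)"
    using pos by (intro ln_mono) auto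
  also have "\<dots> = n * ln (norm z) + ln 2"
  proof -
    have "norm z > 0" using d assms by linarith
    then show ?thesis by (simp add: ln_mult ln_realpow)
  qed
  finally show "ln (norm (z ^ n - w ^ n)) \<le> n * ln (norm z) + ln 2" .
qed

context radial_kernel
begin

lemma integrable_J_mult:
  assumes [measurable]: "f \<in> borel_measurable borel"
    and bd: "\<And>y. norm y < d \<Longrightarrow> \<bar>f y\<bar> \<le> B"
  shows "integrable lborel (\<lambda>y. J y * f y)"
proof (rule Bochner_Integration.integrable_bound)
  show "integrable lborel (\<lambda>y. B * J y)" using J_integrable by simp
  show "AE y in lborel. norm (J y * f y) \<le> norm (B * J y)"
  proof (intro AE_I2)
    fix y show "norm (J y * f y) \<le> norm (B * J y)"
    proof (cases "norm y < d")
      case True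
      then show ?thesis using bd[OF True] J_nonneg[of y]
        by (auto simp: abs_mult mult.commute[of B] intro!: mult_left_mono)
    qed (simp add: J_zero)
  qed
qed auto

lemma integrable_J_ln:
  assumes "d < norm x" "0 < n"
  shows "integrable lborel (\<lambda>y. J y * ln (norm (cplx x ^ n - cplx y ^ n)))"
proof (rule integrable_J_mult)
  fix y :: "real^2" assume "norm y < d"
  then show "\<bar>ln (norm (cplx x ^ n - cplx y ^ n))\<bar> \<le> \<bar>n * ln (norm x) + ln 2\<bar> + \<bar>ln (norm x ^ n - d ^ n)\<bar>"
    using ln_norm_power_diff_bounds[of "cplx y" d "cplx x" n] assms by auto
qed auto

text \<open>Rotating by \<open>\<pi> / n\<close> turns \<open>y\<^sup>n\<close> into \<open>- y\<^sup>n\<close>, and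
  \<open>(x\<^sup>n - y\<^sup>n) (x\<^sup>n + y\<^sup>n) = x\<^sup>2\<^sup>n - y\<^sup>2\<^sup>n\<close>.\<close>

lemma integral_J_ln_double:
  assumes x: "d < norm x" and n: "0 < n"
  shows "(LINT y|lborel. J y * ln (norm (cplx x ^ (2*n) - cplx y ^ (2*n))))
       = 2 * (LINT y|lborel. J y * ln (norm (cplx x ^ n - cplx y ^ n)))"
proof -
  define T where "T = rot (pi / n)"
  define g where "g = (\<lambda>y. J y * ln (norm (cplx x ^ n - cplx y ^ n)))"
  have T: "orthogonal_transformation T" unfolding T_def by (rule orthogonal_transformation_rot)
  have g: "integrable lborel g" unfolding g_def using assms by (rule integrable_J_ln)
  have "J y * ln (norm (cplx x ^ (2*n) - cplx y ^ (2*n))) = g y + g (T y)" for y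
  proof (cases "norm y < d")
    case True
    have nT: "norm (T y) = norm y" using T by (rule orthogonal_transformation_norm)
    have "cplx (T y) ^ n = - (cplx y ^ n)"
      using n by (simp add: T_def cplx_rot power_mult_distrib Complex.DeMoivre)
    then have "norm (cplx x ^ (2*n) - cplx y ^ (2*n)) =
        norm (cplx x ^ n - cplx y ^ n) * norm (cplx x ^ n - cplx (T y) ^ n)"
      by (simp flip: norm_mult add: power_mult power2_eq_square algebra_simps mult_2 power_add)
    moreover have "norm (cplx x ^ n - cplx y ^ n) > 0" "norm (cplx x ^ n - cplx (T y) ^ n) > 0"
      using ln_norm_power_diff_bounds(3)[of "cplx y" d "cplx x" n]
        ln_norm_power_diff_bounds(3)[of "cplx (T y)" d "cplx x" n] True x n nT by auto
    ultimately show ?thesis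
      using J_radial[OF nT] by (simp add: g_def ln_mult distrib_left)
  next
    case False
    then show ?thesis using orthogonal_transformation_norm[OF T, of y] by (simp add: g_def J_zero)
  qed
  then have "(LINT y|lborel. J y * ln (norm (cplx x ^ (2*n) - cplx y ^ (2*n)))) = (LINT y|lborel. g y + g (T y))"
    by simp
  also have "\<dots> = 2 * (LINT y|lborel. g y)"
    using integral_orthogonal[OF T g] g by simp
  finally show ?thesis by (simp add: g_def)
qed

lemma integral_J_ln_pow2:
  assumes "d < norm x"
  shows "(LINT y|lborel. J y * ln (norm (cplx x ^ (2^m) - cplx y ^ (2^m))))
       = 2^m * (LINT y|lborel. J y * ln (norm (x - y)))"
proof (induction m)
  case 0
  have "norm (x - y) = norm (cplx x - cplx y)" for y
    by (simp flip: cplx_diff)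
  then show ?case by simp
next
  case (Suc m)
  then show ?case using integral_J_ln_double[OF assms, of "2^m"] by simp
qed

text \<open>Passing to exponent 2^m multiplies the integral by 2^m, while the pointwise upper bound
  still costs only ln 2. Dividing by 2^m and letting m grow leaves the half of the mean value
  property that a supersolution needs.\<close>

lemma integral_J_ln_le:
  assumes "d < norm x"
  shows "(LINT y|lborel. J y * ln (norm (x - y))) \<le> ln (norm x)"
proof (rule LIMSEQ_le_const)
  show "(\<lambda>m. ln (norm x) + ln 2 / 2^m) \<longlonglongrightarrow> ln (norm x)"
    using tendsto_add[OF tendsto_const LIMSEQ_divide_realpow_zero[of 2 "ln 2"]] by simp
  have "(LINT y|lborel. J y * ln (norm (x - y))) \<le> ln (norm x) + ln 2 / 2^m" for m
  proof -
    have "2^m * (LINT y|lborel. J y * ln (norm (x - y))) \<le> (LINT y|lborel. J y * (2^m * ln (norm x) + ln 2))"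
      unfolding integral_J_ln_pow2[OF assms, symmetric]
    proof (rule integral_mono)
      show "integrable lborel (\<lambda>y. J y * ln (norm (cplx x ^ (2^m) - cplx y ^ (2^m))))"
        using assms by (intro integrable_J_ln) auto
      show "integrable lborel (\<lambda>y. J y * (2^m * ln (norm x) + ln 2))"
        using J_integrable by simp
      fix y show "J y * ln (norm (cplx x ^ (2^m) - cplx y ^ (2^m))) \<le> J y * (2^m * ln (norm x) + ln 2)"
        using ln_norm_power_diff_bounds(2)[of "cplx y" d "cplx x" "2^m"] assms J_nonneg[of y] J_zero[of y]
        by (cases "norm y < d") (auto intro!: mult_left_mono)
    qed
    also have "\<dots> = 2^m * ln (norm x) + ln 2" by (simp add: J_mass)
    also have "\<dots> = 2^m * (ln (norm x) + ln 2 / 2^m)" by (simp add: distrib_left)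
    finally show ?thesis by (simp only: mult_le_cancel_left_pos zero_less_power zero_less_numeral)
  qed
  then show "\<exists>N. \<forall>m\<ge>N. (LINT y|lborel. J y * ln (norm (x - y))) \<le> ln (norm x) + ln 2 / 2^m"
    by blast
qed

end

section \<open>Supersolution with logarithmic growth\<close>

context radial_kernel
begin

text \<open>This is J * f over \<open>lborel\<close>, meant for Borel test functions;
  \<open>convolution\<close> stays in use for the solution, which is only Lebesgue
  measurable.\<close>

definition avg :: "(real^2 \<Rightarrow> real) \<Rightarrow> real^2 \<Rightarrow> real" where
  "avg f x = (LINT y|lborel. J (x - y) * f y)"

lemma avg_measurable [measurable]:
  assumes [measurable]: "f \<in> borel_measurable borel"
  shows "avg f \<in> borel_measurable borel"
  unfolding avg_def by measurable

lemma avg_eq_reflected: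
  assumes [measurable]: "f \<in> borel_measurable borel"
  shows "avg f x = (LINT y|lborel. J y * f (x - y))"
  unfolding avg_def using integral_reflect[of "\<lambda>y. J y * f (x - y)" x] by simp

text \<open>A bound within distance d of x is enough because \<open>J\<close> vanishes further out;
  this admits functions of logarithmic growth.\<close>

lemma integrable_avg:
  assumes [measurable]: "f \<in> borel_measurable borel"
    and bd: "\<And>y. norm (x - y) < d \<Longrightarrow> \<bar>f y\<bar> \<le> B"
  shows "integrable lborel (\<lambda>y. J (x - y) * f y)"
proof -
  have "integrable lborel (\<lambda>y. J y * f (x - y))"
    by (rule integrable_J_mult[where B=B]) (use bd in auto)
  from integrable_reflect[OF this, of x] show ?thesis by simp
qed

lemma avg_mono:
  assumes "f \<in> borel_measurable borel" "g \<in> borel_measurable borel"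
    and "\<And>y. norm (x - y) < d \<Longrightarrow> \<bar>f y\<bar> \<le> B" "\<And>y. norm (x - y) < d \<Longrightarrow> \<bar>g y\<bar> \<le> B'"
    and le: "\<And>y. norm (x - y) < d \<Longrightarrow> f y \<le> g y"
  shows "avg f x \<le> avg g x"
  unfolding avg_def
proof (rule integral_mono)
  fix y show "J (x - y) * f y \<le> J (x - y) * g y"
    using le[of y] J_nonneg[of "x-y"] J_zero[of "x-y"]
    by (cases "norm (x - y) < d") (auto intro: mult_left_mono)
qed (rule integrable_avg[OF assms(1,3)] integrable_avg[OF assms(2,4)], assumption)+

lemma avg_nonneg:
  assumes "\<And>y. 0 \<le> f y"
  shows "0 \<le> avg f x"
  unfolding avg_def using assms J_nonneg by (intro integral_nonneg_AE) auto

lemma avg_const [simp]: "avg (\<lambda>_. c) x = c"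
  using avg_eq_reflected[of "\<lambda>_. c" x] by (simp add: J_mass)

lemma avg_add_cmult:
  assumes "f \<in> borel_measurable borel" "g \<in> borel_measurable borel"
    and "\<And>y. norm (x - y) < d \<Longrightarrow> \<bar>f y\<bar> \<le> B" "\<And>y. norm (x - y) < d \<Longrightarrow> \<bar>g y\<bar> \<le> B'"
  shows "avg (\<lambda>y. a * f y + b * g y) x = a * avg f x + b * avg g x"
  using integrable_avg[of f x B] integrable_avg[of g x B'] assms
  by (simp add: avg_def distrib_left mult.left_commute)

lemma J_inner_lower_bound:
  assumes "r < d"
  obtains m where "0 < m" "\<And>x. norm x \<le> r \<Longrightarrow> m \<le> J x"
proof (cases "0 \<le> r")
  case True
  then have "compact (cball (0::real^2) r)" "cball (0::real^2) r \<noteq> {}" "continuous_on (cball 0 r) J"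
    using continuous_on_subset[OF J_cont] by auto
  then obtain z where z: "z \<in> cball 0 r" "\<And>x. x \<in> cball 0 r \<Longrightarrow> J z \<le> J x"
    using continuous_attains_inf[of "cball 0 r" J] by blast
  show thesis
    by (rule that[of "J z"]) (use z assms in \<open>auto intro!: J_pos\<close>)
next
  case False
  then have "\<not> norm x \<le> r" for x :: "real^2"
    using norm_ge_zero[of x] by linarith
  then show thesis
    using that[of 1] by simp
qed

text \<open>This is a uniform chance of jumping from the disc of radius d + 1 into the disc of
  radius 2. A small ball around a point s x between 0 and x lies in the target and in the region |x
  - y| <= d - e/2, where \<open>J\<close> is bounded below.\<close>

lemma avg_indicator_ball_lower_bound:
  obtains \<delta> where "0 < \<delta>" "\<And>x. norm x \<le> d + 1 \<Longrightarrow> \<delta> \<le> avg (indicator (ball 0 2)) x"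
proof -
  define e where "e = min 1 d / 2"
  have e: "0 < e" "e \<le> 1/2" "e \<le> d/2" using d_pos by (auto simp: e_def)
  obtain m where m: "0 < m" "\<And>x. norm x \<le> d - e/2 \<Longrightarrow> m \<le> J x"
    using J_inner_lower_bound[of "d - e/2"] e by auto
  define \<delta> where "\<delta> = m * measure lborel (ball (0::real^2) (e/2))"
  have "0 < \<delta>"
    using m e by (simp add: \<delta>_def content_ball_pos)
  moreover have "\<delta> \<le> avg (indicator (ball 0 2)) x" if x: "norm x \<le> d + 1" for x
  proof -
    \<comment> \<open>For |x| = d + 1 the point s x has norm 1 + e and distance d - e from x; both
      shrink with |x|. The choice of e leaves room for a ball of radius e/2 in both
      constraints.\<close>
    define s where "s = (1 + e) / (d + 1)"
    have s: "0 \<le> s" "s \<le> 1" using e d_pos by (auto simp: s_def field_simps)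
    have "norm x * s \<le> (d + 1) * s" using x s by (intro mult_right_mono) auto
    then have sx: "norm (s *\<^sub>R x) \<le> 1 + e" using s d_pos e by (simp add: s_def mult.commute abs_of_pos)
    have "(1 - s) * norm x \<le> (1 - s) * (d + 1)" using x s by (intro mult_left_mono) auto
    also have "\<dots> = d - e" using d_pos by (simp add: s_def field_simps)
    finally have sx': "norm (x - s *\<^sub>R x) \<le> d - e"
      using s norm_scaleR[of "1 - s" x] by (simp add: scaleR_left_diff_distrib)
    have "\<delta> = (LINT y|lborel. m * indicator (ball (s *\<^sub>R x) (e/2)) y)"
      using e content_ball[of "e/2" "s *\<^sub>R x"] content_ball[of "e/2" "0::real^2"] by (simp add: \<delta>_def)
    also have "\<dots> \<le> avg (indicator (ball 0 2)) x"
      unfolding avg_def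
    proof (rule integral_mono)
      show "integrable lborel (\<lambda>y. m * indicator (ball (s *\<^sub>R x) (e/2)) y)"
        by (intro integrable_mult_right integrable_real_indicator) (use emeasure_lborel_ball_finite[of "s *\<^sub>R x" "e/2"] in auto)
      show "integrable lborel (\<lambda>y. J (x - y) * indicator (ball 0 2) y)"
        by (rule integrable_avg[where B=1]) (auto simp: indicator_def)
      fix y
      show "m * indicator (ball (s *\<^sub>R x) (e/2)) y \<le> J (x - y) * indicator (ball 0 2) y"
      proof (cases "y \<in> ball (s *\<^sub>R x) (e/2)")
        case True
        then have y: "norm (s *\<^sub>R x - y) < e/2" by (simp add: dist_norm)
        have "norm y \<le> norm (s *\<^sub>R x) + norm (s *\<^sub>R x - y)"
          using norm_triangle_sub[of y "s *\<^sub>R x"] by (simp add: norm_minus_commute)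
        then have "norm y < 2" using y sx e by linarith
        moreover have "norm (x - y) \<le> norm (x - s *\<^sub>R x) + norm (s *\<^sub>R x - y)"
          using norm_triangle_ineq[of "x - s *\<^sub>R x" "s *\<^sub>R x - y"] by simp
        then have "norm (x - y) \<le> d - e/2" using y sx' by linarith
        ultimately show ?thesis using m(2)[of "x - y"] True by (simp del: mem_ball)
      next
        case False
        then show ?thesis using J_nonneg[of "x - y"] by (simp del: mem_ball)
      qed
    qed
    finally show ?thesis .
  qed
  ultimately show thesis by (rule that)
qed

end

section \<open>Averages killed in the hole\<close>

locale exterior_kernel = radial_kernel +
  fixes H :: "(real^2) set"
  assumes open_H: "open H" and ball_subset_H: "ball 0 2 \<subseteq> H"
begin

lemma H_measurable [measurable]: "H \<in> sets borel"
  using open_H by simp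

lemma norm_ge_2: "x \<notin> H \<Longrightarrow> 2 \<le> norm x"
  using ball_subset_H by (auto simp: subset_iff not_less[symmetric])

definition killed_avg :: "(real^2 \<Rightarrow> real) \<Rightarrow> real^2 \<Rightarrow> real" where
  "killed_avg f x = indicator (- H) x * avg f x"

definition supersolution :: "real \<Rightarrow> real^2 \<Rightarrow> real" where
  "supersolution K x = indicator (- H) x * (K + ln (norm x))"

lemma supersolution_measurable [measurable]: "supersolution K \<in> borel_measurable borel"
  unfolding supersolution_def by measurable

lemma supersolution_nonneg: "0 \<le> K \<Longrightarrow> 0 \<le> supersolution K x"
  using norm_ge_2[of x] by (auto simp: supersolution_def indicator_def)

lemma supersolution_bounded:
  assumes "0 \<le> K" "norm (x - y) < d"
  shows "\<bar>supersolution K y\<bar> \<le> K + \<bar>ln (norm x + d)\<bar>"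
proof (cases "y \<in> H")
  case False
  have "norm y \<le> norm x + norm (x - y)"
    using norm_triangle_sub[of y x] by (simp add: norm_minus_commute)
  then have "norm y \<le> norm x + d" using assms by linarith
  then have "ln (norm y) \<le> ln (norm x + d)"
    using norm_ge_2[OF False] by (intro ln_mono) auto
  then show ?thesis
    using supersolution_nonneg[OF assms(1), of y] False by (simp add: supersolution_def)
qed (use assms in \<open>auto simp: supersolution_def\<close>)

text \<open>Away from the hole, \<open>ln \<bar>x\<bar>\<close> is harmonic for the averages against \<open>J\<close>;
  near the hole, the mass of the constant \<open>K\<close> that is lost into it pays for the error.\<close>

lemma killed_avg_supersolution_le:
  obtains K where "0 \<le> K" "\<And>x. killed_avg (supersolution K) x \<le> supersolution K x"
proof -
  obtain \<delta> where \<delta>: "0 < \<delta>" "\<And>x. norm x \<le> d + 1 \<Longrightarrow> \<delta> \<le> avg (indicator (ball 0 2)) x"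
    using avg_indicator_ball_lower_bound by blast
  \<comment> \<open>Thus K times \<open>\<delta>\<close> is ln (2 d + 1), a bound for the logarithm
    at points reachable from |x| <= d + 1: what is lost in the disc of radius 2 cancels the
    growth.\<close>
  define K where "K = ln (2 * d + 1) / \<delta>"
  have K: "0 \<le> K" using d_pos \<delta> by (simp add: K_def)
  have "avg (supersolution K) x \<le> K + ln (norm x)" if x: "x \<notin> H" for x
  proof (cases "norm x \<le> d + 1")
    case True
    let ?I = "indicator (ball 0 2) :: real^2 \<Rightarrow> real"
    have [measurable]: "?I \<in> borel_measurable borel"
      by (intro borel_measurable_indicator) simp
    have "avg (supersolution K) x \<le> avg (\<lambda>y. (K + ln (2*d+1)) * 1 + (- K) * ?I y) x"
    proof (rule avg_mono)
      show "\<bar>supersolution K y\<bar> \<le> K + \<bar>ln (norm x + d)\<bar>" if "norm (x - y) < d" for y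
        using supersolution_bounded[OF K that] .
      show "\<bar>(K + ln (2*d+1)) * 1 + (- K) * indicator (ball 0 2) y\<bar> \<le> K + ln (2*d+1)" for y :: "real^2"
        using K d_pos by (auto simp: indicator_def)
      fix y assume y: "norm (x - y) < d"
      show "supersolution K y \<le> (K + ln (2*d+1)) * 1 + (- K) * indicator (ball 0 2) y"
      proof (cases "y \<in> H")
        case True
        then show ?thesis using K d_pos by (auto simp: supersolution_def indicator_def)
      next
        case False
        have "norm y \<le> norm x + norm (x - y)"
          using norm_triangle_sub[of y x] by (simp add: norm_minus_commute)
        then have "ln (norm y) \<le> ln (2*d+1)"
          using norm_ge_2[OF False] True y by (intro ln_mono) auto
        then show ?thesis
          using False ball_subset_H by (auto simp: supersolution_def indicator_def)
      qed
    qed measurable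
    also have "\<dots> = (K + ln (2*d+1)) * avg (\<lambda>_. 1) x + (- K) * avg (indicator (ball 0 2)) x"
      by (rule avg_add_cmult[where f="\<lambda>_. 1" and g="?I" and B=1 and B'=1]) (measurable, auto simp: indicator_def)
    also have "\<dots> \<le> K + ln (2*d+1) - K * \<delta>"
      using \<delta>(2)[OF True] K by (simp add: mult_left_mono)
    also have "\<dots> = K" using \<delta> by (simp add: K_def)
    also have "\<dots> \<le> K + ln (norm x)" using norm_ge_2[OF x] by simp
    finally show ?thesis .
  next
    case False
    \<comment> \<open>Here |x| > d + 1, so ln |x - y| >= 0 on the support of \<open>J\<close>, and
      cutting the function to 0 in \<open>H\<close> only lowers it.\<close>
    have far: "1 \<le> norm (x - y)" if "norm y < d" for y
      using False that norm_triangle_ineq2[of x y] by linarith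
    have near: "norm (x - y) \<le> norm x + d" if "norm y < d" for y
      using that norm_triangle_ineq4[of x y] by linarith
    have int: "integrable lborel (\<lambda>y. J y * ln (norm (x - y)))"
    proof (rule integrable_J_mult)
      fix y :: "real^2" assume y: "norm y < d"
      show "\<bar>ln (norm (x - y))\<bar> \<le> ln (norm x + d)"
        using far[OF y] ln_mono[OF near[OF y]] by force
    qed measurable
    have "avg (supersolution K) x = (LINT y|lborel. J y * supersolution K (x - y))"
      by (rule avg_eq_reflected) measurable
    also have "\<dots> \<le> (LINT y|lborel. J y * K + J y * ln (norm (x - y)))"
    proof (rule integral_mono)
      show "integrable lborel (\<lambda>y. J y * supersolution K (x - y))"
      proof (rule integrable_J_mult)
        fix y :: "real^2" assume y: "norm y < d"
        show "\<bar>supersolution K (x - y)\<bar> \<le> K + \<bar>ln (norm x + d)\<bar>"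
          using supersolution_bounded[OF K, of x "x - y"] y by simp
      qed measurable
      show "integrable lborel (\<lambda>y. J y * K + J y * ln (norm (x - y)))"
        using int J_integrable by simp
      fix y
      show "J y * supersolution K (x - y) \<le> J y * K + J y * ln (norm (x - y))"
      proof (cases "norm y < d")
        case True
        have "supersolution K (x - y) \<le> K + ln (norm (x - y))"
          using far[OF True] K by (auto simp: supersolution_def indicator_def)
        then show ?thesis
          by (metis J_nonneg distrib_left mult_left_mono)
      qed (simp add: J_zero)
    qed
    also have "\<dots> = K + (LINT y|lborel. J y * ln (norm (x - y)))"
      using int J_integrable by (simp add: J_mass)
    also have "\<dots> \<le> K + ln (norm x)"
      using integral_J_ln_le[of x] False by simp
    finally show ?thesis .
  qed
  then have "killed_avg (supersolution K) x \<le> supersolution K x" for x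
    by (auto simp: killed_avg_def supersolution_def indicator_def)
  with K show thesis by (rule that)
qed

end

section \<open>Decay of the averages of a trigonometric kernel\<close>

text \<open>With w = |z|/2, cos z = 1 - 2 (sin w)^2, and the cubic Taylor bound gives sin w >= 3 w /
  4, whose square is at least w^2 / 2.\<close>

lemma cos_le_1_minus_square:
  fixes z :: real
  assumes "\<bar>z\<bar> \<le> 1"
  shows "cos z \<le> 1 - z\<^sup>2 / 4"
proof -
  define w where "w = \<bar>z\<bar> / 2"
  have w: "0 \<le> w" "w \<le> 1/2" using assms by (auto simp: w_def)
  have "\<bar>sin w - w\<bar> \<le> w^3 / 6"
  proof -
    have *: "(\<Sum>m<3. sin_coeff m * w ^ m) = w" by (simp add: lessThan_nat_numeral sin_coeff_def)
    have "\<bar>sin w - w\<bar> \<le> inverse (fact 3) * \<bar>w\<bar> ^ 3"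
      using Maclaurin_sin_bound[of w 3] unfolding * .
    then show ?thesis using w by (simp add: fact_numeral)
  qed
  moreover have "w^3 \<le> w * (1/4)"
  proof -
    have "w * w \<le> (1/2) * (1/2)" using w by (intro mult_mono) auto
    then have "w * (w * w) \<le> w * (1/4)" using w by (intro mult_left_mono) auto
    then show ?thesis by (simp add: power3_eq_cube mult.assoc)
  qed
  ultimately have "3/4 * w \<le> sin w" using w by linarith
  then have "(3/4 * w)\<^sup>2 \<le> (sin w)\<^sup>2" using w by (intro power_mono) auto
  then have "9/16 * w\<^sup>2 \<le> (sin w)\<^sup>2" by (simp add: power_mult_distrib power_divide)
  then have "w\<^sup>2 / 2 \<le> (sin w)\<^sup>2" using zero_le_power2[of w] by linarith
  moreover have "cos z = 1 - 2 * (sin w)\<^sup>2"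
    using cos_double_sin[of w] by (simp add: w_def)
  moreover have "z\<^sup>2 = 4 * w\<^sup>2" by (simp add: w_def power_divide)
  ultimately show ?thesis by linarith
qed

context radial_kernel
begin

text \<open>The Fourier transform of \<open>J\<close> at the frequency (a, 0), which is real because
  \<open>J\<close> is even.\<close>

definition Jhat :: "real \<Rightarrow> real" where
  "Jhat a = (LINT y|lborel. J y * cos (a * y $ 1))"

lemma integrable_J_cos: "integrable lborel (\<lambda>y. J y * cos (a * y $ 1))"
  by (rule integrable_J_mult[where B=1]) auto

lemma integral_J_sin: "(LINT y|lborel. J y * sin (a * y $ 1)) = 0"
  using integral_reflect[of "\<lambda>y. J y * sin (a * y $ 1)" 0] by (simp add: J_minus)

text \<open>Cosines are eigenfunctions of averaging: in the addition formula the sine part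
  integrates to 0 by symmetry.\<close>

lemma avg_cos: "avg (\<lambda>y. cos (a * y $ 1)) x = Jhat a * cos (a * x $ 1)"
proof -
  have *: "integrable lborel (\<lambda>y. J y * sin (a * y $ 1))"
    by (rule integrable_J_mult[where B=1]) auto
  have "avg (\<lambda>y. cos (a * y $ 1)) x = (LINT y|lborel. J y * cos (a * (x - y) $ 1))"
    by (rule avg_eq_reflected) measurable
  also have "\<dots> = (LINT y|lborel. cos (a * x $ 1) * (J y * cos (a * y $ 1)) + sin (a * x $ 1) * (J y * sin (a * y $ 1)))"
    by (simp add: right_diff_distrib cos_diff algebra_simps)
  also have "\<dots> = cos (a * x $ 1) * (LINT y|lborel. J y * cos (a * y $ 1))
      + sin (a * x $ 1) * (LINT y|lborel. J y * sin (a * y $ 1))"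
    using integrable_J_cos * by simp
  also have "\<dots> = Jhat a * cos (a * x $ 1)"
    by (simp add: integral_J_sin Jhat_def)
  finally show ?thesis .
qed

text \<open>This yields the quadratic decrease of \<open>Jhat\<close> away from 0. On the ball of
  radius d/4 around (d/2, 0), both \<open>J\<close> and the first coordinate are bounded below by
  positive constants.\<close>

lemma J_second_moment_pos: "0 < (LINT y|lborel. J y * (y $ 1)\<^sup>2)"
proof -
  obtain m where m: "0 < m" "\<And>x. norm x \<le> 3 * d / 4 \<Longrightarrow> m \<le> J x"
    using J_inner_lower_bound[of "3 * d / 4"] d_pos by auto
  define z :: "real^2" where "z = (d / 2) *\<^sub>R axis 1 1"
  have nz: "norm z = d / 2" "z $ 1 = d / 2" using d_pos by (simp_all add: z_def)
  have "0 < m * (d / 4)\<^sup>2 * measure lborel (ball z (d / 4))"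
    using m d_pos by (simp add: content_ball_pos)
  also have "\<dots> = (LINT y|lborel. m * (d / 4)\<^sup>2 * indicator (ball z (d / 4)) y)"
    by simp
  also have "\<dots> \<le> (LINT y|lborel. J y * (y $ 1)\<^sup>2)"
  proof (rule integral_mono)
    show "integrable lborel (\<lambda>y. m * (d / 4)\<^sup>2 * indicator (ball z (d / 4)) y)"
      by (intro integrable_mult_right integrable_real_indicator)
        (use emeasure_lborel_ball_finite[of z "d/4"] in auto)
    show "integrable lborel (\<lambda>y. J y * (y $ 1)\<^sup>2)"
    proof (rule integrable_J_mult)
      fix y :: "real^2" assume "norm y < d"
      then show "\<bar>(y $ 1)\<^sup>2\<bar> \<le> d\<^sup>2"
        using component_le_norm_cart[of y 1] d_pos by (simp add: power2_le_iff_abs_le)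
    qed measurable
    fix y :: "real^2"
    show "m * (d / 4)\<^sup>2 * indicator (ball z (d / 4)) y \<le> J y * (y $ 1)\<^sup>2"
    proof (cases "y \<in> ball z (d / 4)")
      case True
      then have y: "norm (z - y) < d / 4" by (simp add: dist_norm)
      have "norm y \<le> 3 * d / 4"
        using norm_triangle_sub[of y z] y nz by (simp add: norm_minus_commute)
      moreover have "d / 4 \<le> y $ 1"
        using component_le_norm_cart[of "z - y" 1] y nz by simp
      then have "(d / 4)\<^sup>2 \<le> (y $ 1)\<^sup>2" using d_pos by (intro power_mono) auto
      ultimately have "m * (d / 4)\<^sup>2 \<le> J y * (y $ 1)\<^sup>2"
        using m(1) m(2)[of y] by (intro mult_mono) auto
      then show ?thesis using True by (simp del: mem_ball)
    qed (simp add: J_nonneg del: mem_ball)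
  qed
  finally show ?thesis .
qed

text \<open>On the support of \<open>J\<close> the argument a y_1 stays in [-1, 1], where the cosine
  is nonnegative and below 1 - z^2 / 4. Integration gives both bounds, with c a quarter of the
  second moment.\<close>

lemma Jhat_bound:
  obtains c where "0 < c" "\<And>a. \<bar>a\<bar> * d \<le> 1 \<Longrightarrow> 0 \<le> Jhat a" "\<And>a. \<bar>a\<bar> * d \<le> 1 \<Longrightarrow> Jhat a \<le> 1 - c * a\<^sup>2"
proof -
  define c where "c = (LINT y|lborel. J y * (y $ 1)\<^sup>2) / 4"
  have small: "\<bar>a * y $ 1\<bar> \<le> 1" if "\<bar>a\<bar> * d \<le> 1" "norm y < d" for a and y :: "real^2"
  proof -
    have "\<bar>a * y $ 1\<bar> \<le> \<bar>a\<bar> * d"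
      using component_le_norm_cart[of y 1] that by (simp add: abs_mult mult_left_mono)
    then show ?thesis using that by linarith
  qed
  \<comment> \<open>By the same convention as for \<open>J_integrable\<close>, a positive integral
    implies integrability.\<close>
  have int: "integrable lborel (\<lambda>y. J y * (y $ 1)\<^sup>2)"
    using J_second_moment_pos not_integrable_integral_eq by fastforce
  show thesis
  proof (rule that)
    show "0 < c" using J_second_moment_pos by (simp add: c_def)
  next
    fix a assume a: "\<bar>a\<bar> * d \<le> 1"
    show "0 \<le> Jhat a"
      unfolding Jhat_def
    proof (rule integral_nonneg_AE, rule AE_I2)
      fix y :: "real^2"
      show "0 \<le> J y * cos (a * y $ 1)"
      proof (cases "norm y < d")
        case True
        then have "0 \<le> cos (a * y $ 1)"
          using small[OF a True] pi_half_gt_zero pi_gt3 by (intro cos_ge_zero) auto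
        then show ?thesis using J_nonneg by simp
      qed (simp add: J_zero)
    qed
    have "Jhat a \<le> (LINT y|lborel. J y - a\<^sup>2 / 4 * (J y * (y $ 1)\<^sup>2))"
      unfolding Jhat_def
    proof (rule integral_mono)
      show "integrable lborel (\<lambda>y. J y - a\<^sup>2 / 4 * (J y * (y $ 1)\<^sup>2))"
        using int J_integrable by simp
      fix y :: "real^2"
      show "J y * cos (a * y $ 1) \<le> J y - a\<^sup>2 / 4 * (J y * (y $ 1)\<^sup>2)"
      proof (cases "norm y < d")
        case True
        have "J y * cos (a * y $ 1) \<le> J y * (1 - (a * y $ 1)\<^sup>2 / 4)"
          using cos_le_1_minus_square[OF small[OF a True]] J_nonneg by (intro mult_left_mono)
        then show ?thesis by (simp add: power_mult_distrib algebra_simps)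
      qed (simp add: J_zero)
    qed (rule integrable_J_cos)
    also have "\<dots> = 1 - c * a\<^sup>2"
      using int J_integrable by (simp add: J_mass c_def)
    finally show "Jhat a \<le> 1 - c * a\<^sup>2" .
  qed
qed

lemma avg_cos_sum:
  assumes "finite I"
  shows "avg (\<lambda>y. \<Sum>i\<in>I. c i * cos (a i * y $ 1)) x = (\<Sum>i\<in>I. c i * Jhat (a i) * cos (a i * x $ 1))"
proof -
  have int: "integrable lborel (\<lambda>y. J (x - y) * cos (a i * y $ 1))" for i
    by (rule integrable_avg[where B=1]) auto
  have "avg (\<lambda>y. \<Sum>i\<in>I. c i * cos (a i * y $ 1)) x = (LINT y|lborel. (\<Sum>i\<in>I. c i * (J (x - y) * cos (a i * y $ 1))))"
    unfolding avg_def by (simp add: sum_distrib_left mult_ac)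
  also have "\<dots> = (\<Sum>i\<in>I. c i * avg (\<lambda>y. cos (a i * y $ 1)) x)"
    using int by (simp add: avg_def)
  finally show ?thesis by (simp add: avg_cos mult.assoc)
qed

section \<open>A Fejer-type kernel and its iterates\<close>

definition freqs :: "nat \<Rightarrow> (nat \<times> nat \<times> real) set" where
  "freqs n = {..<n} \<times> {..<n} \<times> {-1, 1}"

text \<open>Squaring a sum of cosines produces the frequencies m - l and m + l; the triples (m, l,
  s) with a sign s keep them with multiplicity.\<close>

definition freq :: "nat \<Rightarrow> nat \<times> nat \<times> real \<Rightarrow> real" where
  "freq n = (\<lambda>(m, l, s). (real m + s * real l) / (real n)\<^sup>2)"

text \<open>The iterates under \<open>J * _\<close> of the Fejer-type kernel
  \<open>(1/n \<Sum>m<n. cos (m x\<^sub>1 / n\<^sup>2))\<^sup>2\<close>.\<close>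

definition fejer :: "nat \<Rightarrow> nat \<Rightarrow> real^2 \<Rightarrow> real" where
  "fejer n k x = (\<Sum>i\<in>freqs n. Jhat (freq n i) ^ k / (2 * (real n)\<^sup>2) * cos (freq n i * x $ 1))"

lemma finite_freqs [simp]: "finite (freqs n)"
  by (simp add: freqs_def)

lemma sum_freqs: "(\<Sum>i\<in>freqs n. g i) = (\<Sum>m<n. \<Sum>l<n. g (m, l, -1) + g (m, l, 1 :: real))"
proof -
  have split: "(\<Sum>i\<in>X \<times> Y. h i) = (\<Sum>x\<in>X. \<Sum>y\<in>Y. h (x, y))"
    for X :: "nat set" and Y :: "'c set" and h :: "nat \<times> 'c \<Rightarrow> 'b::comm_monoid_add"
    by (subst sum.cartesian_product) simp
  show ?thesis unfolding freqs_def split by simp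
qed

lemma fejer_measurable [measurable]: "fejer n k \<in> borel_measurable borel"
  unfolding fejer_def by measurable

lemma avg_fejer: "avg (fejer n k) x = fejer n (Suc k) x"
  unfolding fejer_def by (subst avg_cos_sum) (simp_all add: field_simps)

text \<open>Product-to-sum formula. The square shows nonnegativity and the size near the origin; the
  cosine sum is the form on which averaging acts.\<close>

lemma fejer_0: "fejer n 0 x = ((\<Sum>m<n. cos (real m / (real n)\<^sup>2 * x $ 1)) / n)\<^sup>2"
proof -
  have freq: "freq n (m, l, -1) * x $ 1 = real m / (real n)\<^sup>2 * x $ 1 - real l / (real n)\<^sup>2 * x $ 1"
    "freq n (m, l, 1) * x $ 1 = real m / (real n)\<^sup>2 * x $ 1 + real l / (real n)\<^sup>2 * x $ 1" for m l
    by (simp_all add: freq_def diff_divide_distrib add_divide_distrib left_diff_distrib distrib_right)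
  have "((\<Sum>m<n. cos (real m / (real n)\<^sup>2 * x $ 1)) / n)\<^sup>2 =
      (\<Sum>m<n. \<Sum>l<n. cos (real m / (real n)\<^sup>2 * x $ 1) * cos (real l / (real n)\<^sup>2 * x $ 1)) / (real n)\<^sup>2"
    unfolding power_divide by (subst (1) power2_eq_square) (simp only: sum_product)
  also have "\<dots> = (\<Sum>m<n. \<Sum>l<n. (cos (freq n (m, l, -1) * x $ 1) + cos (freq n (m, l, 1) * x $ 1)) / 2) / (real n)\<^sup>2"
    unfolding freq cos_times_cos ..
  also have "\<dots> = fejer n 0 x"
    unfolding fejer_def sum_freqs by (simp add: sum_divide_distrib add_divide_distrib)
  finally show ?thesis ..
qed

lemma fejer_nonneg: "0 \<le> fejer n k x"
proof (induction k arbitrary: x)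
  case 0
  show ?case by (simp add: fejer_0)
next
  case (Suc k)
  then show ?case using avg_nonneg[of "fejer n k" x] by (simp add: avg_fejer)
qed

text \<open>All arguments m x_1 / n^2 are at most 1 <= pi/3 in modulus, so each cosine is at least
  1/2. Squaring the mean gives 1/4, whence the factor 4 in \<open>survival_le\<close>.\<close>

lemma fejer_0_lower_bound:
  assumes "0 < n" "\<bar>x $ 1\<bar> \<le> n"
  shows "1 / 4 \<le> fejer n 0 x"
proof -
  have "1 / 2 \<le> cos (real m / (real n)\<^sup>2 * x $ 1)" if m: "m < n" for m
  proof -
    have "\<bar>real m / (real n)\<^sup>2 * x $ 1\<bar> = real m * \<bar>x $ 1\<bar> / (real n)\<^sup>2"
      by (simp add: abs_mult)
    also have "\<dots> \<le> real n * real n / (real n)\<^sup>2"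
      using m assms by (intro divide_right_mono mult_mono) auto
    also have "\<dots> = 1" using assms by (simp add: power2_eq_square)
    finally have le: "\<bar>real m / (real n)\<^sup>2 * x $ 1\<bar> \<le> 1" .
    have "\<bar>real m / (real n)\<^sup>2 * x $ 1\<bar> \<le> pi / 3"
      using pi_gt3 by (intro order_trans[OF le]) simp
    moreover have "pi / 3 \<le> pi" by simp
    ultimately have "cos (pi / 3) \<le> cos \<bar>real m / (real n)\<^sup>2 * x $ 1\<bar>"
      by (intro cos_monotone_0_pi_le abs_ge_zero)
    then show ?thesis by (simp only: cos_abs_real cos_60)
  qed
  then have "(\<Sum>m<n. 1 / 2) \<le> (\<Sum>m<n. cos (real m / (real n)\<^sup>2 * x $ 1))"
    by (intro sum_mono) auto
  then have "1 / 2 \<le> (\<Sum>m<n. cos (real m / (real n)\<^sup>2 * x $ 1)) / n"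
    using assms by (simp add: field_simps)
  then have "(1 / 2)\<^sup>2 \<le> fejer n 0 x"
    unfolding fejer_0 by (intro power_mono) auto
  then show ?thesis by (simp add: power_divide)
qed

lemma fejer_abs_le:
  "\<bar>fejer n k x\<bar> \<le> (\<Sum>i\<in>freqs n. \<bar>Jhat (freq n i)\<bar> ^ k) / (2 * (real n)\<^sup>2)"
proof -
  have "\<bar>Jhat (freq n i) ^ k / (2 * (real n)\<^sup>2) * cos (freq n i * x $ 1)\<bar>
      \<le> \<bar>Jhat (freq n i)\<bar> ^ k / (2 * (real n)\<^sup>2)" for i
    using mult_left_mono[OF abs_cos_le_one, of "\<bar>Jhat (freq n i) ^ k / (2 * (real n)\<^sup>2)\<bar>" "freq n i * x $ 1"]
    by (simp add: abs_mult power_abs)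
  then show ?thesis
    unfolding fejer_def sum_divide_distrib by (intro order_trans[OF sum_abs] sum_mono)
qed

text \<open>The zero frequency contributes a fraction at most \<open>1/n\<close>; all other frequencies lie between
  \<open>1/n\<^sup>2\<close> and \<open>2/n\<close> and are damped by \<open>exp (- c k / n\<^sup>4)\<close>.\<close>

lemma fejer_decay:
  obtains N where "0 < N" "\<And>n k x. N \<le> n \<Longrightarrow> n^6 \<le> k \<Longrightarrow> fejer n k x \<le> 2 / n"
proof -
  obtain c where c: "0 < c" "\<And>a. \<bar>a\<bar> * d \<le> 1 \<Longrightarrow> 0 \<le> Jhat a" "\<And>a. \<bar>a\<bar> * d \<le> 1 \<Longrightarrow> Jhat a \<le> 1 - c * a\<^sup>2"
    using Jhat_bound by blast
  \<comment> \<open>n >= 2 d brings the frequencies, at most 2/n, into the range of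
    \<open>Jhat_bound\<close>; n >= 1/c gives c n^2 >= n below.\<close>
  define N where "N = nat \<lceil>max (1 / c) (2 * d)\<rceil> + 1"
  have "fejer n k x \<le> 2 / n" if n: "N \<le> n" and k: "n^6 \<le> k" for n k x
  proof -
    have N: "0 < n" "1 / c \<le> n" "2 * d \<le> n" using n unfolding N_def by linarith+
    \<comment> \<open>The diagonal m = l contains the zero frequency (s = -1), which is not damped;
      there the trivial bound 1 is used for both signs.\<close>
    have damped: "\<bar>Jhat (freq n (m, l, s))\<bar> ^ k \<le> 1 / n + of_bool (m = l)"
      if ml: "m < n" "l < n" and s: "s \<in> {-1, 1}" for m l s
    proof -
      define a where "a = freq n (m, l, s)"
      have "\<bar>real m + s * real l\<bar> \<le> 2 * n" using ml s by auto
      then have "\<bar>a\<bar> \<le> 2 * n / (real n)\<^sup>2"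
        by (simp add: a_def freq_def divide_right_mono)
      then have "\<bar>a\<bar> \<le> 2 / n" using N by (simp add: power2_eq_square)
      then have "\<bar>a\<bar> * d \<le> 2 / n * d" using d_pos by (intro mult_right_mono) auto
      also have "\<dots> \<le> 1" using N by simp
      finally have ad: "\<bar>a\<bar> * d \<le> 1" .
      have J: "0 \<le> Jhat a" "Jhat a \<le> 1 - c * a\<^sup>2" using c ad by auto
      show ?thesis
      proof (cases "m = l")
        case True
        have "0 \<le> c * a\<^sup>2" using c(1) by simp
        then have "Jhat a \<le> 1" using J by linarith
        then have "\<bar>Jhat a\<bar> ^ k \<le> 1" using J by (simp add: power_le_one)
        then show ?thesis using True by (simp add: a_def add_increasing)
      next
        case False
        have "1 \<le> \<bar>real m + s * real l\<bar>"
          using s False by (auto simp: abs_if)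
        then have "1 / (real n)\<^sup>2 \<le> \<bar>a\<bar>"
          by (simp add: a_def freq_def divide_right_mono)
        then have "(1 / (real n)\<^sup>2)\<^sup>2 \<le> a\<^sup>2"
          by (simp add: abs_le_square_iff[symmetric])
        then have a4: "1 / real n ^ 4 \<le> a\<^sup>2"
          by (simp add: power_divide flip: power_mult)
        have nk: "real n ^ 6 \<le> k" using k by (metis of_nat_le_iff of_nat_power)
        \<comment> \<open>k >= n^6 and a^2 >= 1/n^4 give k c a^2 >= c n^2 >= n, so exp (k c a^2) >=
          n and the k-th power of \<open>Jhat a\<close> is at most 1/n.\<close>
        have "real n \<le> c * real n * real n" using N c by (simp add: field_simps)
        also have "\<dots> = c * (real n ^ 6 * (1 / real n ^ 4))" using N by (simp add: field_simps eval_nat_numeral)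
        also have "\<dots> \<le> c * (k * a\<^sup>2)" using a4 nk c by (intro mult_left_mono mult_mono) auto
        finally have "real n \<le> k * (c * a\<^sup>2)" by (simp add: mult_ac)
        then have ge: "real n \<le> exp (k * (c * a\<^sup>2))" using exp_ge_add_one_self[of "k * (c * a\<^sup>2)"] by linarith
        have "Jhat a \<le> exp (- (c * a\<^sup>2))" using J exp_ge_add_one_self[of "- (c * a\<^sup>2)"] by linarith
        then have "\<bar>Jhat a\<bar> ^ k \<le> exp (- (c * a\<^sup>2)) ^ k" using J by (intro power_mono) auto
        also have "\<dots> = 1 / exp (k * (c * a\<^sup>2))" by (simp add: exp_of_nat_mult exp_minus power_inverse divide_inverse)
        also have "\<dots> \<le> 1 / n" using ge N by (intro divide_left_mono) auto
        finally show ?thesis using False by (simp add: a_def)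
      qed
    qed
    have "fejer n k x \<le> (\<Sum>i\<in>freqs n. \<bar>Jhat (freq n i)\<bar> ^ k) / (2 * (real n)\<^sup>2)"
      using fejer_abs_le[of n k x] by linarith
    also have "\<dots> \<le> (\<Sum>m<n. \<Sum>l<n. 2 * (1 / n + of_bool (m = l))) / (2 * (real n)\<^sup>2)"
      unfolding sum_freqs
    proof (intro divide_right_mono sum_mono)
      fix m l assume "m \<in> {..<n}" "l \<in> {..<n}"
      then show "\<bar>Jhat (freq n (m, l, -1))\<bar> ^ k + \<bar>Jhat (freq n (m, l, 1))\<bar> ^ k \<le> 2 * (1 / n + of_bool (m = l))"
        using damped[of m l "-1"] damped[of m l 1] by simp
    qed simp
    also have "(\<Sum>m<n. \<Sum>l<n. 2 * (1 / n + of_bool (m = l))) = (\<Sum>m<n. 2 * (1 + 1) :: real)"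
    proof (rule sum.cong)
      fix m assume "m \<in> {..<n}"
      then show "(\<Sum>l<n. 2 * (1 / n + of_bool (m = l))) = (2 * (1 + 1) :: real)"
        using N by (simp add: sum.distrib of_bool_def sum_distrib_left[symmetric])
    qed simp
    also have "\<dots> / (2 * (real n)\<^sup>2) = 2 / n" using N by (simp add: power2_eq_square)
    finally show ?thesis .
  qed
  then show thesis by (intro that[of N]) (auto simp: N_def)
qed

end

section \<open>Survival probabilities\<close>

text \<open>Induction on N for all k at once: the remainder r of \<open>a k\<close> vanishes at 0
  and its derivative is the remainder of \<open>a (Suc k)\<close> one order lower, so g - r and g +
  r are increasing. Only interior derivatives enter, as the evolution equation holds for t >
  0.\<close>

lemma taylor_chain_bound:
  fixes a :: "nat \<Rightarrow> real \<Rightarrow> real"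
  assumes cont: "\<And>k. continuous_on {0..T} (a k)"
    and deriv: "\<And>k t. 0 < t \<Longrightarrow> t < T \<Longrightarrow> (a k has_real_derivative a (Suc k) t) (at t)"
    and bound: "\<And>k t. 0 \<le> t \<Longrightarrow> t \<le> T \<Longrightarrow> \<bar>a k t\<bar> \<le> D"
    and t: "0 \<le> t" "t \<le> T"
  shows "\<bar>a k t - (\<Sum>j<N. t^j / fact j * a (k + j) 0)\<bar> \<le> D * t^N / fact N"
  using t
proof (induction N arbitrary: k t)
  case 0
  then show ?case using bound by simp
next
  case (Suc N)
  define r where "r = (\<lambda>t. a k t - (\<Sum>j<Suc N. t^j / fact j * a (k + j) 0))"
  define r' where "r' = (\<lambda>t. a (Suc k) t - (\<Sum>j<N. t^j / fact j * a (Suc k + j) 0))"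
  define g where "g = (\<lambda>t. D * t^Suc N / fact (Suc N))"
  have r0: "r 0 = 0"
    by (simp add: r_def sum.lessThan_Suc_shift del: sum.lessThan_Suc)
  have g0: "g 0 = 0" by (simp add: g_def)
  have r_alt: "r t = a k t - (a k 0 + (\<Sum>j<N. t^Suc j / fact (Suc j) * a (k + Suc j) 0))" for t
    by (simp add: r_def sum.lessThan_Suc_shift del: sum.lessThan_Suc)
  have monomial: "((\<lambda>t. t^Suc j / fact (Suc j) * c) has_real_derivative s^j / fact j * c) (at s)" for j s c
    by (auto intro!: derivative_eq_intros simp: fact_reduce simp del: power_Suc)
  have dr: "(r has_real_derivative r' s) (at s)" if "0 < s" "s < t" for s
  proof -
    have "((\<lambda>t. \<Sum>j<N. t^Suc j / fact (Suc j) * a (k + Suc j) 0) has_real_derivative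
        (\<Sum>j<N. s^j / fact j * a (k + Suc j) 0)) (at s)"
      by (intro DERIV_sum monomial)
    from DERIV_diff[OF deriv[of s k] DERIV_add[OF DERIV_const[of "a k 0"] this]] that Suc.prems
    show ?thesis unfolding r_alt[abs_def] r'_def by simp
  qed
  have dg: "(g has_real_derivative D * s^N / fact N) (at s)" for s
    unfolding g_def using monomial[of N D s] by (simp add: mult.commute mult.left_commute)
  have r'_bound: "\<bar>r' s\<bar> \<le> D * s^N / fact N" if "0 < s" "s < t" for s
    unfolding r'_def using Suc.IH[of s "Suc k"] that Suc.prems by auto
  have cr: "continuous_on {0..t} r" "continuous_on {0..t} g"
    unfolding r_def g_def using Suc.prems
    by (intro continuous_intros continuous_on_subset[OF cont[of k]]; simp)+
  have "g 0 - r 0 \<le> g t - r t"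
  proof (rule DERIV_nonneg_imp_increasing_open[where f="\<lambda>t. g t - r t"])
    fix s assume s: "0 < s" "s < t"
    show "\<exists>y. ((\<lambda>t. g t - r t) has_real_derivative y) (at s) \<and> 0 \<le> y"
      using DERIV_diff[OF dg dr[OF s]] r'_bound[OF s] by (intro exI conjI) (assumption, simp)
  qed (use Suc.prems continuous_on_diff[OF cr(2,1)] in auto)
  moreover have "g 0 + r 0 \<le> g t + r t"
  proof (rule DERIV_nonneg_imp_increasing_open[where f="\<lambda>t. g t + r t"])
    fix s assume s: "0 < s" "s < t"
    show "\<exists>y. ((\<lambda>t. g t + r t) has_real_derivative y) (at s) \<and> 0 \<le> y"
      using DERIV_add[OF dg dr[OF s]] r'_bound[OF s] by (intro exI conjI) (assumption, simp)
  qed (use Suc.prems continuous_on_add[OF cr(2,1)] in auto)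
  ultimately have "\<bar>r t\<bar> \<le> g t" using r0 g0 by linarith
  then show ?case by (simp add: r_def g_def)
qed

text \<open>\<open>D\<close> does not depend on k, so the remainder D t^N / N! tends to 0.\<close>

lemma taylor_chain_sums:
  fixes a :: "nat \<Rightarrow> real \<Rightarrow> real"
  assumes "\<And>k. continuous_on {0..t} (a k)"
    and "\<And>k s. 0 < s \<Longrightarrow> s < t \<Longrightarrow> (a k has_real_derivative a (Suc k) s) (at s)"
    and "\<And>k s. 0 \<le> s \<Longrightarrow> s \<le> t \<Longrightarrow> \<bar>a k s\<bar> \<le> D"
    and t: "0 \<le> t"
  shows "(\<lambda>j. t^j / fact j * a j 0) sums a 0 t"
  unfolding sums_def
proof (rule Lim_transform2)
  show "(\<lambda>_. a 0 t) \<longlonglongrightarrow> a 0 t" by simp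
  have "(\<lambda>N. a 0 t - (\<Sum>j<N. t^j / fact j * a j 0)) \<longlonglongrightarrow> 0"
  proof (rule Lim_null_comparison)
    show "\<forall>\<^sub>F N in sequentially. norm (a 0 t - (\<Sum>j<N. t^j / fact j * a j 0)) \<le> D * (t^N / fact N)"
      using taylor_chain_bound[where a=a and T=t and D=D and t=t and k=0] assms by auto
    show "(\<lambda>N. D * (t^N / fact N)) \<longlonglongrightarrow> 0"
      using tendsto_mult_right_zero[OF summable_LIMSEQ_zero[OF summable_exp[of t]], of D]
      by (simp add: divide_inverse mult.commute)
  qed
  then show "(\<lambda>N. a 0 t - (\<Sum>j<N. t^j / fact j * a j 0)) \<longlonglongrightarrow> 0" .
qed

text \<open>Since \<open>m / (k + 1) \<ge> 1\<close> for \<open>k < m\<close>, the terms with \<open>k < m\<close> are absorbed by the expectation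
  of \<open>1 / (k + 1)\<close> under the Poisson distribution, which is at most \<open>1 / t\<close>.\<close>

lemma poisson_average_le:
  fixes b :: "nat \<Rightarrow> real"
  assumes sums: "(\<lambda>k. t^k / fact k * b k) sums (exp t * M)"
    and t: "0 < t" and "0 \<le> M0" "0 \<le> e"
    and b: "\<And>k. b k \<le> M0" "\<And>k. m \<le> k \<Longrightarrow> b k \<le> e"
  shows "M \<le> M0 * m / t + e"
proof -
  have ex: "(\<lambda>k. t^k / fact k) sums exp t"
    using exp_converges[of t] by (simp add: divide_inverse mult.commute)
  \<comment> \<open>The weight t^k / k! divided by k + 1 is 1/t times t^(k+1) / (k+1)!; the shifted
    series misses the zeroth term 1.\<close>
  have "(\<lambda>k. t^Suc k / fact (Suc k)) sums (exp t - 1)"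
    using ex by (subst sums_Suc_iff) simp
  then have sums': "(\<lambda>k. M0 * m / t * (t^Suc k / fact (Suc k)) + e * (t^k / fact k)) sums (M0 * m / t * (exp t - 1) + e * exp t)"
    by (intro sums_add sums_mult ex)
  have le: "t^k / fact k * b k \<le> M0 * m / t * (t^Suc k / fact (Suc k)) + e * (t^k / fact k)" for k
  proof -
    have "b k \<le> M0 * m / (k + 1) + e"
    proof (cases "m \<le> k")
      case True
      have "0 \<le> M0 * m / (k + 1)" using assms by simp
      then show ?thesis using b(2)[OF True] by linarith
    next
      case False
      then have "M0 * (k + 1) \<le> M0 * m" using assms by (intro mult_left_mono) auto
      then have "M0 \<le> M0 * m / (k + 1)" by (simp add: field_simps)
      then show ?thesis using b(1)[of k] assms by linarith
    qed
    then have "t^k / fact k * b k \<le> t^k / fact k * (M0 * m / (k + 1) + e)"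
      using t by (intro mult_left_mono) auto
    also have "\<dots> = M0 * m / t * (t^Suc k / fact (Suc k)) + e * (t^k / fact k)"
    proof -
      define p where "p = t^k / fact k"
      define c where "c = real k + 1"
      have p: "t^Suc k / fact (Suc k) = t * p / c"
        by (simp add: p_def c_def field_simps)
      have "0 < c" by (simp add: c_def)
      then have "p * (M0 * m / c + e) = M0 * m / t * (t * p / c) + e * p"
        using t by (simp add: field_simps)
      then show ?thesis unfolding p by (simp add: p_def c_def add.commute)
    qed
    finally show ?thesis .
  qed
  have "exp t * M \<le> M0 * m / t * (exp t - 1) + e * exp t"
    using le sums sums' by (rule sums_le)
  also have "\<dots> \<le> M0 * m / t * exp t + e * exp t"
    using assms by (intro add_mono mult_left_mono) auto
  also have "\<dots> = exp t * (M0 * m / t + e)" by (simp add: algebra_simps)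
  finally show ?thesis by simp
qed

section \<open>Survival of the killed walk and comparison\<close>

context exterior_kernel
begin

definition survival :: "nat \<Rightarrow> real^2 \<Rightarrow> real" where
  "survival k = (killed_avg ^^ k) (indicator (- H))"

lemma survival_0: "survival 0 = indicator (- H)"
  and survival_Suc: "survival (Suc k) = killed_avg (survival k)"
  by (simp_all add: survival_def)

lemma killed_avg_measurable [measurable]:
  assumes [measurable]: "f \<in> borel_measurable borel"
  shows "killed_avg f \<in> borel_measurable borel"
  unfolding killed_avg_def by measurable

lemma survival_measurable [measurable]: "survival k \<in> borel_measurable borel"
  by (induction k) (simp_all add: survival_0 survival_Suc)

lemma survival_eq_0: "x \<in> H \<Longrightarrow> survival k x = 0"
  by (cases k) (simp_all add: survival_0 survival_Suc killed_avg_def)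

lemma survival_range: "0 \<le> survival k x \<and> survival k x \<le> 1"
proof (induction k arbitrary: x)
  case 0
  show ?case by (simp add: survival_0 indicator_def)
next
  case (Suc k)
  have "0 \<le> avg (survival k) x" using Suc by (intro avg_nonneg) auto
  moreover have "avg (survival k) x \<le> avg (\<lambda>_. 1) x"
    by (rule avg_mono[where B=1 and B'=1]) (use Suc in auto)
  ultimately show ?case by (auto simp: survival_Suc killed_avg_def indicator_def)
qed

text \<open>Induction on k. At first 4 \<open>fejer\<close> covers the strip |x_1| <= n, and the
  logarithm, at least ln n outside it, covers the rest. Averaging sends \<open>fejer n k\<close> to
  \<open>fejer n (Suc k)\<close> exactly and does not increase the supersolution off
  \<open>H\<close>; in \<open>H\<close> the left side is 0.\<close>

lemma survival_le:
  assumes K: "0 \<le> K" "\<And>x. killed_avg (supersolution K) x \<le> supersolution K x" and n: "2 \<le> n"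
  shows "survival k x \<le> 4 * fejer n k x + 1 / ln n * supersolution K x"
proof (induction k arbitrary: x)
  case 0
  have ln: "0 < ln n" using n by simp
  show ?case
  proof (cases "x \<in> H")
    case True
    then show ?thesis using fejer_nonneg[of n 0 x] by (simp add: survival_0 supersolution_def)
  next
    case False
    show ?thesis
    proof (cases "\<bar>x $ 1\<bar> \<le> n")
      case True
      then have "1 / 4 \<le> fejer n 0 x" using n by (intro fejer_0_lower_bound) auto
      moreover have "0 \<le> 1 / ln n * supersolution K x"
        using supersolution_nonneg[OF K(1)] ln by simp
      ultimately show ?thesis using False by (simp add: survival_0)
    next
      case far: False
      then have "ln n \<le> ln (norm x)"
        using component_le_norm_cart[of x 1] n by (intro ln_mono) auto
      then have "1 \<le> 1 / ln n * supersolution K x"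
        using False K ln by (simp add: supersolution_def)
      then show ?thesis using False fejer_nonneg[of n 0 x] by (simp add: survival_0)
    qed
  qed
next
  case (Suc k)
  have ln: "0 < ln n" using n by simp
  define C where "C = (\<Sum>i\<in>freqs n. \<bar>Jhat (freq n i)\<bar> ^ k) / (2 * (real n)\<^sup>2)"
  have C: "\<bar>fejer n k y\<bar> \<le> C" for y
    unfolding C_def by (rule fejer_abs_le)
  define S where "S = K + \<bar>ln (norm x + d)\<bar>"
  have S: "\<bar>supersolution K y\<bar> \<le> S" if "norm (x - y) < d" for y
    unfolding S_def using supersolution_bounded[OF K(1) that] .
  have "avg (survival k) x \<le> avg (\<lambda>y. 4 * fejer n k y + 1 / ln n * supersolution K y) x"
  proof (rule avg_mono[where B=1 and B'="4 * C + 1 / ln n * S"])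
    fix y assume y: "norm (x - y) < d"
    have "\<bar>4 * fejer n k y\<bar> \<le> 4 * C" using C[of y] by (simp add: abs_mult)
    moreover have "\<bar>1 / ln n * supersolution K y\<bar> \<le> 1 / ln n * S"
      using S[OF y] ln by (simp add: abs_mult divide_right_mono)
    ultimately show "\<bar>4 * fejer n k y + 1 / ln n * supersolution K y\<bar> \<le> 4 * C + 1 / ln n * S"
      by linarith
  qed (use Suc survival_range in auto)
  also have "\<dots> = 4 * avg (fejer n k) x + 1 / ln n * avg (supersolution K) x"
    by (rule avg_add_cmult[where f="fejer n k" and g="supersolution K" and B=C and B'=S]) (use C S in auto)
  finally have *: "avg (survival k) x \<le> 4 * fejer n (Suc k) x + 1 / ln n * avg (supersolution K) x"
    by (simp add: avg_fejer)
  show ?case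
  proof (cases "x \<in> H")
    case True
    then show ?thesis using fejer_nonneg[of n "Suc k" x] by (simp add: survival_eq_0 supersolution_def)
  next
    case False
    then have "avg (supersolution K) x \<le> supersolution K x"
      using K(2)[of x] by (simp add: killed_avg_def)
    then have "1 / ln n * avg (supersolution K) x \<le> 1 / ln n * supersolution K x"
      using ln by (intro mult_left_mono) auto
    then show ?thesis using * False by (simp add: survival_Suc killed_avg_def)
  qed
qed

end

section \<open>The exterior problem\<close>

context radial_kernel
begin

text \<open>|f| <= 1 and the unit mass of \<open>J\<close> bound the inner integral of the modulus
  by |w y|; this licenses Fubini in \<open>convolution_duality\<close>.\<close>

lemma integrable_J_kernel:
  assumes w: "integrable lborel w" and [measurable]: "f \<in> borel_measurable borel" and f: "\<And>x. \<bar>f x\<bar> \<le> 1"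
  shows "integrable (lborel \<Otimes>\<^sub>M lborel) (\<lambda>(y, x). f x * (J (x - y) * w y))"
proof (rule lborel_pair.Fubini_integrable)
  have [measurable]: "w \<in> borel_measurable borel" using w by auto
  show "(\<lambda>(y, x). f x * (J (x - y) * w y)) \<in> borel_measurable (lborel \<Otimes>\<^sub>M lborel)"
    by measurable
  have J: "integrable lborel (\<lambda>x. J (x - y))" for y
    using integrable_reflect[OF J_integrable, of y] J_commute[of y] by simp
  have Jf: "integrable lborel (\<lambda>x. f x * (J (x - y) * c))" for y c
  proof (rule Bochner_Integration.integrable_bound)
    show "integrable lborel (\<lambda>x. c * J (x - y))" using J by simp
    show "AE x in lborel. norm (f x * (J (x - y) * c)) \<le> norm (c * J (x - y))"
    proof (intro AE_I2)
      fix x show "norm (f x * (J (x - y) * c)) \<le> norm (c * J (x - y))"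
        using mult_right_mono[OF f[of x], of "\<bar>J (x - y) * c\<bar>"] by (simp add: abs_mult mult.commute)
    qed
  qed auto
  show "AE y in lborel. integrable lborel (\<lambda>x. case (y, x) of (y, x) \<Rightarrow> f x * (J (x - y) * w y))"
    using Jf by simp
  have 1: "(LINT x|lborel. J (x - y)) = 1" for y
    using integral_reflect[of J y] J_commute[of y] by (simp add: J_mass)
  show "integrable lborel (\<lambda>y. LINT x|lborel. norm (case (y, x) of (y, x) \<Rightarrow> f x * (J (x - y) * w y)))"
  proof (rule Bochner_Integration.integrable_bound)
    show "integrable lborel (\<lambda>y. \<bar>w y\<bar>)" using w by simp
    show "AE y in lborel. norm (LINT x|lborel. norm (case (y, x) of (y, x) \<Rightarrow> f x * (J (x - y) * w y))) \<le> norm \<bar>w y\<bar>"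
    proof (intro AE_I2)
      fix y
      have "(LINT x|lborel. \<bar>f x * (J (x - y) * w y)\<bar>) \<le> (LINT x|lborel. J (x - y) * \<bar>w y\<bar>)"
      proof (rule integral_mono)
        fix x show "\<bar>f x * (J (x - y) * w y)\<bar> \<le> J (x - y) * \<bar>w y\<bar>"
          using mult_right_mono[OF f[of x], of "\<bar>J (x - y) * w y\<bar>"] J_nonneg[of "x - y"]
          by (simp add: abs_mult)
      qed (use J Jf in \<open>auto intro!: integrable_abs\<close>)
      then show "norm (LINT x|lborel. norm (case (y, x) of (y, x) \<Rightarrow> f x * (J (x - y) * w y))) \<le> norm \<bar>w y\<bar>"
        by (simp add: 1)
    qed
  qed measurable
qed

text \<open>Averaging is self-adjoint: exchange the integrals and use J (x - y) = J (y - x).\<close>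

lemma convolution_duality:
  assumes w: "integrable lebesgue w" and [measurable]: "f \<in> borel_measurable borel" and f: "\<And>x. \<bar>f x\<bar> \<le> 1"
  shows "integrable lebesgue (\<lambda>x. convolution J w x * f x)"
    and "(LINT x|lebesgue. convolution J w x * f x) = (LINT x|lebesgue. w x * avg f x)"
proof -
  \<comment> \<open>A Borel representative makes the integrand measurable on the product and leaves
    \<open>convolution J w\<close> unchanged at every point.\<close>
  obtain w' where w'[measurable]: "w' \<in> borel_measurable borel" and ae: "AE x in lborel. w x = w' x"
    using completion_ex_borel_measurable_real[of w lborel] w by auto
  have ael: "AE x in lebesgue. w x = w' x" using AE_completion[OF ae] .
  have wm: "w \<in> borel_measurable lebesgue"
    using w by (rule borel_measurable_integrable)
  have w'm: "w' \<in> borel_measurable lebesgue"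
    by (rule measurable_completion) simp
  have "integrable lebesgue w'"
    using w integrable_cong_AE[OF wm w'm ael] by simp
  then have w'i: "integrable lborel w'" by (simp add: integrable_completion)
  have conv: "convolution J w x = avg w' x" for x
  proof -
    have Jm: "(\<lambda>y. J (x - y)) \<in> borel_measurable lebesgue"
      by (intro measurable_completion) simp
    have "convolution J w x = (LINT y|lebesgue. J (x - y) * w' y)"
      unfolding convolution_def using ael wm w'm Jm
      by (intro integral_cong_AE) auto
    also have "\<dots> = avg w' x"
      unfolding avg_def by (intro integral_completion) simp
    finally show ?thesis .
  qed
  have int2: "integrable (lborel \<Otimes>\<^sub>M lborel) (\<lambda>(y, x). f x * (J (x - y) * w' y))"
    by (rule integrable_J_kernel[OF w'i]) (use f in auto)
  have "integrable lborel (\<lambda>x. LINT y|lborel. f x * (J (x - y) * w' y))"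
    using lborel_pair.integrable_snd[OF int2] by simp
  then have "integrable lborel (\<lambda>x. avg w' x * f x)"
    by (simp add: avg_def mult.commute)
  then show "integrable lebesgue (\<lambda>x. convolution J w x * f x)"
    unfolding conv by (simp add: integrable_completion)
  have "(LINT x|lebesgue. convolution J w x * f x) = (LINT x|lborel. LINT y|lborel. f x * (J (x - y) * w' y))"
    unfolding conv by (subst integral_completion) (auto simp: avg_def mult.commute)
  also have "\<dots> = (LINT y|lborel. LINT x|lborel. f x * (J (x - y) * w' y))"
    using lborel_pair.Fubini_integral[OF int2] .
  also have "\<dots> = (LINT y|lborel. w' y * avg f y)"
  proof (rule Bochner_Integration.integral_cong)
    fix y
    have "(LINT x|lborel. f x * (J (x - y) * w' y)) = (LINT x|lborel. w' y * (J (y - x) * f x))"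
      by (simp add: J_commute[of _ y] mult_ac)
    then show "(LINT x|lborel. f x * (J (x - y) * w' y)) = w' y * avg f y"
      by (simp add: avg_def)
  qed simp
  also have "\<dots> = (LINT y|lebesgue. w' y * avg f y)"
    by (subst integral_completion) auto
  also have "\<dots> = (LINT x|lebesgue. w x * avg f x)"
  proof (rule integral_cong_AE)
    have "avg f \<in> borel_measurable lebesgue" by (intro measurable_completion) simp
    then show "(\<lambda>y. w' y * avg f y) \<in> borel_measurable lebesgue" "(\<lambda>y. w y * avg f y) \<in> borel_measurable lebesgue"
      using wm w'm by auto
    show "AE x in lebesgue. w' x * avg f x = w x * avg f x" using ael by eventually_elim simp
  qed
  finally show "(LINT x|lebesgue. convolution J w x * f x) = (LINT x|lebesgue. w x * avg f x)" .
qed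

end

lemma integrable_mult_bounded:
  fixes w f :: "real^2 \<Rightarrow> real"
  assumes w: "integrable lebesgue w" and f: "f \<in> borel_measurable borel" "\<And>x. \<bar>f x\<bar> \<le> 1"
  shows "integrable lebesgue (\<lambda>x. w x * f x)" and "\<bar>LINT x|lebesgue. w x * f x\<bar> \<le> (LINT x|lebesgue. \<bar>w x\<bar>)"
proof -
  have fm: "f \<in> borel_measurable lebesgue" using f by (intro measurable_completion) simp
  have le: "\<bar>w x * f x\<bar> \<le> \<bar>w x\<bar>" for x
    using mult_left_mono[OF f(2)[of x], of "\<bar>w x\<bar>"] by (simp add: abs_mult)
  show i: "integrable lebesgue (\<lambda>x. w x * f x)"
    using w fm le by (intro Bochner_Integration.integrable_bound[OF w]) auto
  have "\<bar>LINT x|lebesgue. w x * f x\<bar> \<le> (LINT x|lebesgue. \<bar>w x * f x\<bar>)"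
    by (rule integral_abs_bound)
  also have "\<dots> \<le> (LINT x|lebesgue. \<bar>w x\<bar>)"
    using i w le by (intro integral_mono) auto
  finally show "\<bar>LINT x|lebesgue. w x * f x\<bar> \<le> (LINT x|lebesgue. \<bar>w x\<bar>)" .
qed

section \<open>Testing the solution against bounded functions\<close>

locale exterior_problem = exterior_kernel +
  fixes u0 :: "real^2 \<Rightarrow> real" and u :: "real \<Rightarrow> real^2 \<Rightarrow> real"
  assumes u0_nonneg: "AE x in lebesgue. u0 x \<ge> 0" and u0_H: "AE x in lebesgue. x \<in> H \<longrightarrow> u0 x = 0"
    and u0_log: "in_L1_log u0" and solution: "exterior_solution J H u0 u"
begin

lemma u_integrable: "0 \<le> t \<Longrightarrow> integrable lebesgue (u t)"
  and u_continuous: "0 \<le> t \<Longrightarrow> ((\<lambda>s. LINT x|lebesgue. \<bar>u s x - u t x\<bar>) \<longlongrightarrow> 0) (at t within {0..})"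
  and u_deriv: "0 < t \<Longrightarrow> ((\<lambda>h. LINT x:(- H)|lebesgue. \<bar>(u (t + h) x - u t x) / h - nonlocal_op J (u t) x\<bar>) \<longlongrightarrow> 0) (at 0)"
  and u_H: "0 < t \<Longrightarrow> AE x in lebesgue. x \<in> H \<longrightarrow> u t x = 0"
  and u_0: "AE x in lebesgue. u 0 x = u0 x"
  using solution by (auto simp: exterior_solution_def continuous_into_L1_def)

text \<open>Pairings do not see the choice of representatives and turn calculus in L^1 into calculus
  of real functions.\<close>

definition pairing :: "(real^2 \<Rightarrow> real) \<Rightarrow> real \<Rightarrow> real" where
  "pairing f t = (LINT x|lebesgue. u t x * f x)"

lemma pairing_diff_le:
  assumes "f \<in> borel_measurable borel" "\<And>x. \<bar>f x\<bar> \<le> 1" "0 \<le> s" "0 \<le> t"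
  shows "\<bar>pairing f s - pairing f t\<bar> \<le> (LINT x|lebesgue. \<bar>u s x - u t x\<bar>)"
proof -
  have "pairing f s - pairing f t = (LINT x|lebesgue. (u s x - u t x) * f x)"
    unfolding pairing_def using integrable_mult_bounded(1)[OF u_integrable assms(1,2)] assms
    by (simp add: left_diff_distrib)
  then show ?thesis
    using integrable_mult_bounded(2)[of "\<lambda>x. u s x - u t x" f] u_integrable assms by auto
qed

lemma pairing_continuous:
  assumes "f \<in> borel_measurable borel" "\<And>x. \<bar>f x\<bar> \<le> 1"
  shows "continuous_on {0..} (pairing f)"
  unfolding continuous_on_def
proof
  fix t :: real assume t: "t \<in> {0..}"
  have "((\<lambda>s. pairing f s - pairing f t) \<longlongrightarrow> 0) (at t within {0..})"
  proof (rule Lim_null_comparison)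
    show "\<forall>\<^sub>F s in at t within {0..}. norm (pairing f s - pairing f t) \<le> (LINT x|lebesgue. \<bar>u s x - u t x\<bar>)"
      using pairing_diff_le[OF assms] t by (auto simp: eventually_at_filter)
  qed (use u_continuous t in auto)
  then show "(pairing f \<longlongrightarrow> pairing f t) (at t within {0..})"
    by (simp add: LIM_zero_iff)
qed

text \<open>The L^1 norm is continuous in time, hence bounded on compact intervals; this supplies
  the uniform bound for the Taylor chain.\<close>

lemma L1_norm_bounded: "\<exists>D. \<forall>s\<in>{0..t}. (LINT x|lebesgue. \<bar>u s x\<bar>) \<le> D"
proof -
  have "continuous_on {0..} (\<lambda>s. LINT x|lebesgue. \<bar>u s x\<bar>)"
    unfolding continuous_on_def
  proof
    fix t :: real assume t: "t \<in> {0..}"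
    have "((\<lambda>s. (LINT x|lebesgue. \<bar>u s x\<bar>) - (LINT x|lebesgue. \<bar>u t x\<bar>)) \<longlongrightarrow> 0) (at t within {0..})"
    proof (rule Lim_null_comparison)
      have "\<bar>(LINT x|lebesgue. \<bar>u s x\<bar>) - (LINT x|lebesgue. \<bar>u t x\<bar>)\<bar> \<le> (LINT x|lebesgue. \<bar>u s x - u t x\<bar>)" if s: "0 \<le> s" for s
      proof -
        have i: "integrable lebesgue (u s)" "integrable lebesgue (u t)" using u_integrable s t by auto
        then have "(LINT x|lebesgue. \<bar>u s x\<bar>) - (LINT x|lebesgue. \<bar>u t x\<bar>) = (LINT x|lebesgue. \<bar>u s x\<bar> - \<bar>u t x\<bar>)"
          by simp
        then have "\<bar>(LINT x|lebesgue. \<bar>u s x\<bar>) - (LINT x|lebesgue. \<bar>u t x\<bar>)\<bar> \<le> (LINT x|lebesgue. \<bar>\<bar>u s x\<bar> - \<bar>u t x\<bar>\<bar>)"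
          by simp
        also have "\<dots> \<le> (LINT x|lebesgue. \<bar>u s x - u t x\<bar>)"
          using i by (intro integral_mono integrable_abs Bochner_Integration.integrable_diff abs_triangle_ineq3)
        finally show ?thesis .
      qed
      then show "\<forall>\<^sub>F s in at t within {0..}. norm ((LINT x|lebesgue. \<bar>u s x\<bar>) - (LINT x|lebesgue. \<bar>u t x\<bar>)) \<le> (LINT x|lebesgue. \<bar>u s x - u t x\<bar>)"
        by (auto simp: eventually_at_filter)
    qed (use u_continuous t in auto)
    then show "((\<lambda>s. LINT x|lebesgue. \<bar>u s x\<bar>) \<longlongrightarrow> (LINT x|lebesgue. \<bar>u t x\<bar>)) (at t within {0..})"
      by (simp add: LIM_zero_iff)
  qed
  then have "compact ((\<lambda>s. LINT x|lebesgue. \<bar>u s x\<bar>) ` {0..t})"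
    by (intro compact_continuous_image) (auto elim: continuous_on_subset)
  then obtain D where "\<forall>y\<in>(\<lambda>s. LINT x|lebesgue. \<bar>u s x\<bar>) ` {0..t}. norm y \<le> D"
    using bounded_iff compact_imp_bounded by metis
  then show ?thesis by (intro exI[of _ D]) auto
qed

text \<open>Since f vanishes in \<open>H\<close> and |f| <= 1, L^1 convergence of the difference
  quotients off \<open>H\<close> passes to the pairing. Duality moves the operator onto f, and
  \<open>killed_avg f\<close> may replace \<open>avg f\<close> because u(.,t) vanishes in
  \<open>H\<close>.\<close>

lemma pairing_deriv:
  assumes f: "f \<in> borel_measurable borel" "\<And>x. \<bar>f x\<bar> \<le> 1" "\<And>x. x \<in> H \<Longrightarrow> f x = 0" and t: "0 < t"
  shows "(pairing f has_real_derivative pairing (killed_avg f) t - pairing f t) (at t)"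
proof -
  have ut: "integrable lebesgue (u t)" using u_integrable t by simp
  have conv: "integrable lebesgue (convolution J (u t))"
    using convolution_duality(1)[OF ut, of "\<lambda>_. 1"] by simp
  have op: "integrable lebesgue (nonlocal_op J (u t))"
    unfolding nonlocal_op_def using conv ut by simp
  have "pairing (killed_avg f) t = (LINT x|lebesgue. u t x * avg f x)"
    unfolding pairing_def
  proof (rule integral_cong_AE)
    have "killed_avg f \<in> borel_measurable lebesgue" "avg f \<in> borel_measurable lebesgue"
      using f(1) by (auto intro!: measurable_completion)
    then show "(\<lambda>x. u t x * killed_avg f x) \<in> borel_measurable lebesgue" "(\<lambda>x. u t x * avg f x) \<in> borel_measurable lebesgue"
      using ut by auto
    show "AE x in lebesgue. u t x * killed_avg f x = u t x * avg f x"
      using u_H[OF t] by eventually_elim (auto simp: killed_avg_def)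
  qed
  then have "pairing (killed_avg f) t = (LINT x|lebesgue. convolution J (u t) x * f x)"
    using convolution_duality(2)[OF ut f(1,2)] by simp
  then have D: "pairing (killed_avg f) t - pairing f t = (LINT x|lebesgue. nonlocal_op J (u t) x * f x)"
    unfolding pairing_def nonlocal_op_def
    using convolution_duality(1)[OF ut f(1,2)] integrable_mult_bounded(1)[OF ut f(1,2)]
    by (simp add: left_diff_distrib)
  have "((\<lambda>h. (pairing f (t + h) - pairing f t) / h - (pairing (killed_avg f) t - pairing f t)) \<longlongrightarrow> 0) (at 0)"
  proof (rule Lim_null_comparison[OF _ u_deriv[OF t]])
    have "norm ((pairing f (t + h) - pairing f t) / h - (pairing (killed_avg f) t - pairing f t))
        \<le> (LINT x:(- H)|lebesgue. \<bar>(u (t + h) x - u t x) / h - nonlocal_op J (u t) x\<bar>)"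
      if h: "\<bar>h\<bar> < t" "h \<noteq> 0" for h
    proof -
      define w where "w = (\<lambda>x. (u (t + h) x - u t x) / h - nonlocal_op J (u t) x)"
      have uh: "integrable lebesgue (u (t + h))" using u_integrable h by simp
      have w: "integrable lebesgue w" unfolding w_def using uh ut op by simp
      have wf: "w x * f x = (u (t + h) x * f x - u t x * f x) / h - nonlocal_op J (u t) x * f x" for x
        by (simp add: w_def left_diff_distrib)
      have eq: "(pairing f (t + h) - pairing f t) / h - (pairing (killed_avg f) t - pairing f t) = (LINT x|lebesgue. w x * f x)"
        unfolding D wf unfolding pairing_def
        using integrable_mult_bounded(1)[OF ut f(1,2)] integrable_mult_bounded(1)[OF uh f(1,2)]
          integrable_mult_bounded(1)[OF op f(1,2)] by simp
      have "\<bar>LINT x|lebesgue. w x * f x\<bar> \<le> (LINT x|lebesgue. \<bar>w x * f x\<bar>)"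
        by (rule integral_abs_bound)
      also have "\<dots> \<le> (LINT x:(- H)|lebesgue. \<bar>w x\<bar>)"
        unfolding set_lebesgue_integral_def
      proof (rule integral_mono)
        show "integrable lebesgue (\<lambda>x. \<bar>w x * f x\<bar>)"
          using integrable_mult_bounded(1)[OF w f(1,2)] by simp
        show "integrable lebesgue (\<lambda>x. indicator (- H) x *\<^sub>R \<bar>w x\<bar>)"
          using w open_H by (intro integrable_mult_indicator integrable_abs) auto
        fix x show "\<bar>w x * f x\<bar> \<le> indicator (- H) x *\<^sub>R \<bar>w x\<bar>"
          using mult_left_mono[OF f(2)[of x], of "\<bar>w x\<bar>"] f(3)[of x]
          by (cases "x \<in> H") (auto simp: abs_mult)
      qed
      finally show ?thesis unfolding eq w_def by simp
    qed
    moreover have "\<forall>\<^sub>F h in at 0. \<bar>h\<bar> < t \<and> h \<noteq> (0::real)"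
      using t by (auto simp: eventually_at dist_real_def intro!: exI[of _ t])
    ultimately show "\<forall>\<^sub>F h in at 0. norm ((pairing f (t + h) - pairing f t) / h - (pairing (killed_avg f) t - pairing f t))
        \<le> (LINT x:(- H)|lebesgue. \<bar>(u (t + h) x - u t x) / h - nonlocal_op J (u t) x\<bar>)"
      by (auto elim: eventually_mono)
  qed
  then show ?thesis
    unfolding DERIV_def by (simp add: LIM_zero_iff)
qed

text \<open>Duhamel's formula: \<open>u\<close> is the density of a walk with Poisson clock and jump density \<open>J\<close>,
  killed in \<open>H\<close>, and \<open>survival k\<close> is the probability to survive \<open>k\<close> jumps.\<close>

lemma mass_sums:
  assumes t: "0 < t"
  shows "(\<lambda>k. t^k / fact k * (LINT x|lebesgue. u0 x * survival k x)) sums (exp t * mass u t)"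
proof -
  \<comment> \<open>The factor exp s absorbs the negative term in \<open>pairing_deriv\<close>, so
    \<open>a k\<close> has derivative \<open>a (Suc k)\<close>.\<close>
  define a where "a = (\<lambda>k s. exp s * pairing (survival k) s)"
  have q1: "\<bar>survival k x\<bar> \<le> 1" for k x using survival_range[of k x] by auto
  obtain D where D: "\<And>s. s \<in> {0..t} \<Longrightarrow> (LINT x|lebesgue. \<bar>u s x\<bar>) \<le> D"
    using L1_norm_bounded[of t] by blast
  have sums: "(\<lambda>k. t^k / fact k * a k 0) sums a 0 t"
  proof (rule taylor_chain_sums)
    show "continuous_on {0..t} (a k)" for k
      unfolding a_def by (intro continuous_intros continuous_on_subset[OF pairing_continuous]) (use q1 in auto)
    show "(a k has_real_derivative a (Suc k) s) (at s)" if s: "0 < s" "s < t" for k s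
    proof -
      have "(pairing (survival k) has_real_derivative pairing (survival (Suc k)) s - pairing (survival k) s) (at s)"
        unfolding survival_Suc by (rule pairing_deriv) (use q1 survival_eq_0 s in auto)
      from DERIV_mult[OF DERIV_exp this] show ?thesis
        by (simp add: a_def algebra_simps)
    qed
    show "\<bar>a k s\<bar> \<le> exp t * D" if s: "0 \<le> s" "s \<le> t" for k s
    proof -
      have "\<bar>pairing (survival k) s\<bar> \<le> D"
        unfolding pairing_def
        using integrable_mult_bounded(2)[OF u_integrable survival_measurable q1, of s k] D[of s] s by auto
      then show ?thesis unfolding a_def using s by (auto simp: abs_mult intro!: mult_mono)
    qed
  qed (use t in auto)
  have init: "a k 0 = (LINT x|lebesgue. u0 x * survival k x)" for k
  proof -
    have "survival k \<in> borel_measurable lebesgue" by (intro measurable_completion) simp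
    then have "pairing (survival k) 0 = (LINT x|lebesgue. u0 x * survival k x)"
      unfolding pairing_def using u_0 u_integrable[of 0] u0_log
      by (intro integral_cong_AE) (auto simp: in_L1_log_def)
    then show ?thesis by (simp add: a_def)
  qed
  have final: "a 0 t = exp t * mass u t"
  proof -
    have qm: "survival 0 \<in> borel_measurable lebesgue" by (intro measurable_completion) simp
    have um: "u t \<in> borel_measurable lebesgue"
      using t by (intro borel_measurable_integrable u_integrable) simp
    have "pairing (survival 0) t = mass u t"
      unfolding pairing_def mass_def
    proof (rule integral_cong_AE)
      show "AE x in lebesgue. u t x * survival 0 x = u t x"
        using u_H[OF t] by eventually_elim (auto simp: survival_0 indicator_def)
    qed (use qm um in auto)
    then show ?thesis by (simp add: a_def)
  qed
  show ?thesis using sums unfolding init final .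
qed

text \<open>Inherited from u(.,0), an L^1 function that equals \<open>u0\<close> almost
  everywhere.\<close>

lemma u0_integrable: "integrable lebesgue u0"
proof (rule integrable_cong_AE_imp)
  show "integrable lebesgue (u 0)" by (rule u_integrable) simp
  show "u0 \<in> borel_measurable lebesgue" using u0_log by (simp add: in_L1_log_def)
qed (rule u_0)

section \<open>Logarithmic decay of the mass\<close>

text \<open>Integrate \<open>survival_le\<close> against \<open>u0\<close>. The kernel contributes
  at most 8/n times the initial mass, with 1/n <= 1/ln n; the supersolution contributes 1/ln n times
  an integral made finite by the logarithmic moment of \<open>u0\<close>.\<close>

lemma initial_average_le:
  obtains N :: nat and C :: real where "2 \<le> N" "0 \<le> C"
    "\<And>(n::nat) k. N \<le> n \<Longrightarrow> n^6 \<le> k \<Longrightarrow> (LINT x|lebesgue. u0 x * survival k x) \<le> C / ln n"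
proof -
  obtain K where K: "0 \<le> K" "\<And>x. killed_avg (supersolution K) x \<le> supersolution K x"
    using killed_avg_supersolution_le by blast
  obtain N where N: "0 < N" "\<And>n k x. N \<le> n \<Longrightarrow> n^6 \<le> k \<Longrightarrow> fejer n k x \<le> 2 / n"
    using fejer_decay by blast
  define M0 where "M0 = (LINT x|lebesgue. u0 x)"
  define S where "S = (LINT x|lebesgue. K * u0 x + u0 x * ln (norm x))"
  have int: "integrable lebesgue (\<lambda>x. K * u0 x + u0 x * ln (norm x))"
    using u0_integrable u0_log by (auto simp: in_L1_log_def)
  have M0: "0 \<le> M0"
    unfolding M0_def using u0_nonneg by (rule integral_nonneg_AE)
  have S: "0 \<le> S"
    unfolding S_def
  proof (rule integral_nonneg_AE)
    show "AE x in lebesgue. 0 \<le> K * u0 x + u0 x * ln (norm x)"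
      using u0_nonneg u0_H
    proof eventually_elim
      case (elim x)
      then show ?case using norm_ge_2[of x] K by (cases "x \<in> H") auto
    qed
  qed
  have bound: "(LINT x|lebesgue. u0 x * survival k x) \<le> (8 * M0 + S) / ln n"
    if n: "max N 2 \<le> n" and k: "n^6 \<le> k" for n k :: nat
  proof -
    have ln: "0 < ln n" using n by simp
    have q1: "\<bar>survival k x\<bar> \<le> 1" for x using survival_range[of k x] by auto
    have "(LINT x|lebesgue. u0 x * survival k x)
        \<le> (LINT x|lebesgue. 8 / n * u0 x + 1 / ln n * (K * u0 x + u0 x * ln (norm x)))"
    proof (rule integral_mono_AE)
      show "integrable lebesgue (\<lambda>x. u0 x * survival k x)"
        using u0_integrable q1 by (intro integrable_mult_bounded) auto
      show "integrable lebesgue (\<lambda>x. 8 / n * u0 x + 1 / ln n * (K * u0 x + u0 x * ln (norm x)))"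
        using integrable_mult_right[OF u0_integrable, of "8 / n"] integrable_mult_right[OF int, of "1 / ln n"]
        by (rule Bochner_Integration.integrable_add)
      show "AE x in lebesgue. u0 x * survival k x \<le> 8 / n * u0 x + 1 / ln n * (K * u0 x + u0 x * ln (norm x))"
        using u0_nonneg u0_H
      proof eventually_elim
        case (elim x)
        show ?case
        proof (cases "x \<in> H")
          case False
          have "survival k x \<le> 4 * fejer n k x + 1 / ln n * supersolution K x"
            using n by (intro survival_le[OF K]) auto
          also have "\<dots> \<le> 8 / n + 1 / ln n * (K + ln (norm x))"
            using N(2)[of n k x] n k False by (simp add: supersolution_def)
          finally have "u0 x * survival k x \<le> u0 x * (8 / n + 1 / ln n * (K + ln (norm x)))"
            using elim by (intro mult_left_mono)
          also have "\<dots> = 8 / n * u0 x + 1 / ln n * (K * u0 x + u0 x * ln (norm x))"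
            by (simp add: algebra_simps add_divide_distrib)
          finally show ?thesis .
        qed (use elim in auto)
      qed
    qed
    also have "\<dots> = 8 / n * M0 + 1 / ln n * S"
      unfolding M0_def S_def using u0_integrable int
      by (subst Bochner_Integration.integral_add) auto
    also have "\<dots> \<le> 8 / ln n * M0 + 1 / ln n * S"
    proof -
      have "ln n \<le> n" using n ln_le_minus_one[of "real n"] by simp
      then have "8 / n \<le> 8 / ln n" using ln n by (intro divide_left_mono) auto
      from mult_right_mono[OF this M0] show ?thesis by simp
    qed
    also have "\<dots> = (8 * M0 + S) / ln n" by (simp add: add_divide_distrib)
    finally show ?thesis .
  qed
  show thesis
    by (rule that[of "max N 2" "8 * M0 + S"]) (use bound M0 S in auto)
qed

lemma mass_decay: "\<exists>t0>1. \<exists>C0>0. \<forall>t\<ge>t0. mass u t \<le> C0 / ln t"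
proof -
  define M0 where "M0 = (LINT x|lebesgue. u0 x)"
  have M0: "0 \<le> M0" unfolding M0_def using u0_nonneg by (rule integral_nonneg_AE)
  obtain N :: nat and C :: real where N: "2 \<le> N" "0 \<le> C"
    and C: "\<And>(n::nat) k. N \<le> n \<Longrightarrow> n^6 \<le> k \<Longrightarrow> (LINT x|lebesgue. u0 x * survival k x) \<le> C / ln n"
    by (rule initial_average_le) (rule that)
  have le: "(LINT x|lebesgue. u0 x * survival k x) \<le> M0" for k
    unfolding M0_def
  proof (rule integral_mono_AE)
    have q1: "\<bar>survival k x\<bar> \<le> 1" for x using survival_range[of k x] by auto
    show "integrable lebesgue (\<lambda>x. u0 x * survival k x)"
      using u0_integrable q1 by (intro integrable_mult_bounded) auto
    show "AE x in lebesgue. u0 x * survival k x \<le> u0 x"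
      using u0_nonneg
    proof eventually_elim
      case (elim x)
      then show ?case using mult_left_mono[of "survival k x" 1 "u0 x"] survival_range[of k x] by simp
    qed
  qed (rule u0_integrable)
  \<comment> \<open>The summand 1 keeps the constant positive even if M0 and C vanish.\<close>
  have "mass u t \<le> (24 * (M0 + C) + 1) / ln t" if t: "real N ^ 12 \<le> t" for t
  proof -
    \<comment> \<open>n^12 <= t gives n^6 / t <= 1 / ln n, which settles the indices below n^6,
      while t < (n + 1)^12 <= n^24 gives ln t <= 24 ln n.\<close>
    define n where "n = nat \<lfloor>root 12 t\<rfloor>"
    have N12: "1 \<le> real N ^ 12" using N by simp
    then have t1: "1 \<le> t" using t by linarith
    have "real N \<le> root 12 t"
      using real_root_le_mono[OF _ t, of 12] by (simp add: real_root_power_cancel)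
    then have n: "N \<le> n" "real n \<le> root 12 t" "root 12 t < real n + 1"
      unfolding n_def by linarith+
    have n2: "2 \<le> n" using N n by linarith
    have rt: "root 12 t ^ 12 = t" using t1 by simp
    have nt: "real n ^ 12 \<le> t"
      using power_mono[OF n(2), of 12] rt by simp
    have "t < (real n + 1) ^ 12"
      using power_strict_mono[OF n(3), of 12] rt t1 by simp
    also have "\<dots> \<le> (real n ^ 2) ^ 12"
    proof (rule power_mono)
      have "real n + 1 \<le> 2 * real n" using n2 by simp
      also have "\<dots> \<le> real n * real n" using n2 by (intro mult_right_mono) auto
      finally show "real n + 1 \<le> real n ^ 2" by (simp add: power2_eq_square)
    qed simp
    also have "\<dots> = real n ^ 24" by (simp flip: power_mult)
    finally have "ln t \<le> ln (real n ^ 24)" using t1 by (intro ln_mono) auto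
    then have lnt: "ln t \<le> 24 * ln n" using n2 by (simp add: ln_realpow)
    have lnn: "0 < ln n" using n2 by simp
    have lnt0: "0 < ln t"
    proof -
      have "1 < real n ^ 12" using n2 by (intro one_less_power) auto
      then show ?thesis using nt by simp
    qed
    have "mass u t \<le> M0 * real (n ^ 6) / t + C / ln n"
    proof (rule poisson_average_le[where m="n ^ 6"])
      show "(\<lambda>k. t^k / fact k * (LINT x|lebesgue. u0 x * survival k x)) sums (exp t * mass u t)"
        using t1 by (intro mass_sums) auto
    qed (use t1 M0 N lnn le C n in auto)
    also have "\<dots> \<le> M0 / ln n + C / ln n"
    proof -
      have "ln n * real n ^ 6 \<le> real n ^ 6 * real n ^ 6"
      proof (rule mult_right_mono)
        have "ln n \<le> n" using n2 ln_le_minus_one[of "real n"] by simp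
        also have "\<dots> \<le> real n ^ 6" using n2 by (intro self_le_power) auto
        finally show "ln n \<le> real n ^ 6" .
      qed simp
      also have "\<dots> \<le> t" using nt by (simp flip: power_add)
      finally have "real n ^ 6 / t \<le> 1 / ln n" using lnn t1 by (simp add: field_simps)
      then have "M0 * (real n ^ 6 / t) \<le> M0 * (1 / ln n)" using M0 by (intro mult_left_mono)
      then show ?thesis by simp
    qed
    also have "\<dots> = (M0 + C) / ln n" by (simp add: add_divide_distrib)
    also have "\<dots> \<le> 24 * (M0 + C) / ln t"
    proof -
      have "(M0 + C) * ln t \<le> (M0 + C) * (24 * ln n)" using lnt M0 N by (intro mult_left_mono) auto
      then show ?thesis using lnn lnt0 by (simp add: field_simps)
    qed
    also have "\<dots> \<le> (24 * (M0 + C) + 1) / ln t" using lnt0 by (simp add: divide_right_mono)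
    finally show ?thesis .
  qed
  moreover have "1 < real N ^ 12" using N by (intro one_less_power) auto
  ultimately show ?thesis
    using M0 N by (intro exI[of _ "real N ^ 12"] conjI exI[of _ "24 * (M0 + C) + 1"]) auto
qed

end

theorem proposition3p2:
  fixes H :: "(real^2) set" and R d :: real
    and J u0 :: "real^2 \<Rightarrow> real"
    and u :: "real \<Rightarrow> real^2 \<Rightarrow> real"
  assumes "H \<noteq> {}" and "bounded H" and "open H"
    and "2 < R" and "ball 0 2 \<subseteq> H" and "H \<subseteq> ball 0 R"
    and "C2 J" and "compactly_supported J" and "radially_symmetric J"
    and "0 < d" and "\<And>x. norm x < d \<Longrightarrow> J x > 0" and "\<And>x. norm x \<ge> d \<Longrightarrow> J x = 0"
    and "(LINT x|lebesgue. J x) = 1"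
    and "AE x in lebesgue. u0 x \<ge> 0" and "AE x in lebesgue. x \<in> H \<longrightarrow> u0 x = 0"
    and "in_L_infinity u0" and "in_L1_log u0"
    and "exterior_solution J H u0 u"
  shows "\<exists>t0>1. \<exists>C0>0. \<forall>t\<ge>t0. mass u t \<le> C0 / ln t"
proof -
  have cont: "continuous_on UNIV J"
    using \<open>C2 J\<close> unfolding C2_def
    by (metis continuous_at_imp_continuous_on has_derivative_continuous)
  \<comment> \<open>For a Borel function the integrals over \<open>lebesgue\<close> and
    \<open>lborel\<close> agree, which transfers the mass of \<open>J\<close> to the locale.\<close>
  then have "J \<in> borel_measurable lborel"
    by (simp add: borel_measurable_continuous_onI)
  then have mass: "(LINT x|lborel. J x) = 1"
    using integral_completion[of J lborel] assms(13) by simp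
  have radial: "J x = J y" if "norm x = norm y" for x y
    using \<open>radially_symmetric J\<close> that unfolding radially_symmetric_def by blast
  interpret exterior_problem J d H u0 u
    by unfold_locales (fact cont radial mass assms)+
  show ?thesis by (rule mass_decay)
qed

end
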